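(* If $G$ is a finite soluble group and $H$ is a proper subgroup of $G$, then $\max(H,G)\le |G:H|-1$. In particular, every finite soluble transitive permutation group of degree $n\ge 2$ has at most $n-1$ maximal systems of imprimitivity.
   Context: For a finite group $G$ and a subgroup $H\le G$, $\max(H,G)$ denotes the number of maximal subgroups $M$ of $G$ with $H\le M$. A maximal system of imprimitivity of a transitive permutation group is a nontrivial $G$-invariant partition of the domain that is maximal among the $G$-invariant partitions other than the partition consisting of the whole domain as a single block. *)

theory Defs
  imports "HOL-Algebra.Algebra" "HOL-Library.Disjoint_Sets"
begin

definition maximal_subgroup :: "'a set \<Rightarrow> ('a, 'b) monoid_scheme \<Rightarrow> bool" where
  "maximal_subgroup M G \<longleftrightarrow> subgroup M G \<and> M \<noteq> carrier G \<and>
     (\<forall>K. subgroup K G \<and> M \<subseteq> K \<longrightarrow> K = M \<or> K = carrier G)"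

definition max_count :: "'a set \<Rightarrow> ('a, 'b) monoid_scheme \<Rightarrow> nat" where
  "max_count H G = card {M. maximal_subgroup M G \<and> H \<subseteq> M}"

text \<open>A permutation group on \<Omega> is a subgroup P of BijGroup \<Omega>.\<close>
definition perm_transitive :: "'a set \<Rightarrow> ('a \<Rightarrow> 'a) set \<Rightarrow> bool" where
  "perm_transitive \<Omega> P \<longleftrightarrow> (\<forall>x\<in>\<Omega>. \<forall>y\<in>\<Omega>. \<exists>g\<in>P. g x = y)"

definition invariant_partition :: "'a set \<Rightarrow> ('a \<Rightarrow> 'a) set \<Rightarrow> 'a set set \<Rightarrow> bool" where
  "invariant_partition \<Omega> P \<P> \<longleftrightarrow> partition_on \<Omega> \<P> \<and> (\<forall>g\<in>P. \<forall>B\<in>\<P>. g ` B \<in> \<P>)"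

definition refines :: "'a set set \<Rightarrow> 'a set set \<Rightarrow> bool" where
  "refines \<P> Q \<longleftrightarrow> (\<forall>B\<in>\<P>. \<exists>C\<in>Q. B \<subseteq> C)"

definition system_of_imprimitivity :: "'a set \<Rightarrow> ('a \<Rightarrow> 'a) set \<Rightarrow> 'a set set \<Rightarrow> bool" where
  "system_of_imprimitivity \<Omega> P \<P> \<longleftrightarrow> invariant_partition \<Omega> P \<P> \<and>
     \<P> \<noteq> {\<Omega>} \<and> \<P> \<noteq> {{x} | x. x \<in> \<Omega>}"

definition maximal_system_of_imprimitivity :: "'a set \<Rightarrow> ('a \<Rightarrow> 'a) set \<Rightarrow> 'a set set \<Rightarrow> bool" where
  "maximal_system_of_imprimitivity \<Omega> P \<P> \<longleftrightarrow> system_of_imprimitivity \<Omega> P \<P> \<and>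
     (\<forall>Q. invariant_partition \<Omega> P Q \<and> Q \<noteq> {\<Omega>} \<and> refines \<P> Q \<longrightarrow> Q = \<P>)"

end

theory Submission
  imports Defs
begin

text \<open>
  Induct on \<open>|G : H|\<close> inside the fixed group \<open>G\<close>. Choose an abelian chief factor \<open>N/L\<close> of \<open>G\<close> with
  \<open>L \<subseteq> H\<close> and \<open>N\<close> not inside \<open>H\<close>. The maximal subgroups containing \<open>HN\<close> number at most
  \<open>|G : HN| - 1\<close>. Any other maximal \<open>M \<supseteq> H\<close> satisfies \<open>MN = G\<close> and \<open>M \<inter> N = L\<close>, and with
  \<open>C = C_G(N/L)\<close> the intersection \<open>K = M \<inter> C\<close> is a normal complement of \<open>N\<close> in \<open>C\<close> modulo \<open>L\<close>.
  Two distinct such \<open>K\<close> generate \<open>C\<close>, so a second moment count bounds their number \<open>e\<close> by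
  \<open>|C : H \<inter> C| / q\<close>, where \<open>q = |N : L|\<close>; that is, \<open>e |G : HC| \<le> |G : HN|\<close>.

  If \<open>HC = G\<close>, then \<open>M = H (M \<inter> C)\<close> is determined by \<open>K\<close>. Otherwise at most \<open>q\<close> of the \<open>M\<close> share the
  same \<open>K\<close>, because they are conjugate (Galois), while \<open>|G : HC| \<ge> 2\<close>. In both cases there are at most
  \<open>(q - 1) |G : HN| = |G : H| - |G : HN|\<close> such \<open>M\<close>.

  For a transitive group, the stabilizer of the block through a point \<open>x\<close> embeds the maximal systems of
  imprimitivity into the maximal subgroups that contain the stabilizer of \<open>x\<close>.
\<close>

section \<open>Counting in finite groups\<close>

context group
begin

section \<open>Words in group elements and orders of products\<close>

lemma inv_mult_cancel: "x \<in> carrier G \<Longrightarrow> y \<in> carrier G \<Longrightarrow> inv x \<otimes> (x \<otimes> y) = y"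
  by (metis inv_closed l_inv l_one m_assoc)

lemma mult_inv_cancel: "x \<in> carrier G \<Longrightarrow> y \<in> carrier G \<Longrightarrow> x \<otimes> (inv x \<otimes> y) = y"
  by (metis inv_closed r_inv l_one m_assoc)

text \<open>These rules right-associate a word, push inverses onto its letters and cancel inverse
  neighbours anywhere in it. With them \<open>simp\<close> proves the conjugation and commutator
  identities below.\<close>

lemmas word_simps = m_assoc inv_mult_group inv_mult_cancel mult_inv_cancel

text \<open>The fibre of multiplication over \<open>h \<otimes> k\<close> consists of the pairs
  \<open>(h \<otimes> x, inv x \<otimes> k)\<close> with \<open>x\<close> in
  \<open>H \<inter> K\<close>, so all fibres have the same size.\<close>

lemma card_set_mult:
  assumes "subgroup H G" "subgroup K G" "finite (carrier G)"
  shows "card (H <#> K) * card (H \<inter> K) = card H * card K"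
proof -
  interpret H: subgroup H G by fact
  interpret K: subgroup K G by fact
  let ?f = "\<lambda>(h, k). h \<otimes> k"
  have fin: "finite (H \<times> K)"
    using assms(3) H.subset K.subset finite_subset by blast
  have im: "?f ` (H \<times> K) = H <#> K"
    by (auto simp: set_mult_def image_iff)
  have fib: "card {p \<in> H \<times> K. ?f p = z} = card (H \<inter> K)" if z: "z \<in> H <#> K" for z
  proof -
    obtain h k where hk: "h \<in> H" "k \<in> K" "z = h \<otimes> k"
      using z by (auto simp: set_mult_def)
    have "bij_betw (\<lambda>x. (h \<otimes> x, inv x \<otimes> k)) (H \<inter> K) {p \<in> H \<times> K. ?f p = z}"
    proof (rule bij_betwI[where g = "\<lambda>(a, b). inv h \<otimes> a"])
      show "(\<lambda>x. (h \<otimes> x, inv x \<otimes> k)) \<in> H \<inter> K \<rightarrow> {p \<in> H \<times> K. ?f p = z}"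
        using hk by (auto simp: word_simps)
      show "(\<lambda>(a, b). inv h \<otimes> a) \<in> {p \<in> H \<times> K. ?f p = z} \<rightarrow> H \<inter> K"
      proof
        fix p assume "p \<in> {p \<in> H \<times> K. ?f p = z}"
        then obtain a b where p: "p = (a, b)" and ab: "a \<in> H" "b \<in> K" "a \<otimes> b = z"
          by auto
        have "inv h \<otimes> a = inv h \<otimes> (a \<otimes> b) \<otimes> inv b"
          using ab(1,2) hk(1) by (simp add: word_simps)
        also have "\<dots> = k \<otimes> inv b"
          using ab hk by (simp add: word_simps)
        finally have "inv h \<otimes> a \<in> K"
          using ab hk by simp
        then show "(case p of (a, b) \<Rightarrow> inv h \<otimes> a) \<in> H \<inter> K"
          using p ab hk by simp
      qed
      show "(case (h \<otimes> x, inv x \<otimes> k) of (a, b) \<Rightarrow> inv h \<otimes> a) = x" if "x \<in> H \<inter> K" for x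
        using that hk by (simp add: word_simps)
      show "(\<lambda>x. (h \<otimes> x, inv x \<otimes> k)) (case p of (a, b) \<Rightarrow> inv h \<otimes> a) = p"
        if p0: "p \<in> {p \<in> H \<times> K. ?f p = z}" for p
      proof -
        obtain a b where p: "p = (a, b)" "a \<in> H" "b \<in> K" "a \<otimes> b = h \<otimes> k"
          using p0 hk(3) by auto
        have "inv a \<otimes> (h \<otimes> k) = b"
          using p(2,3) by (simp add: p(4)[symmetric] word_simps)
        then show ?thesis
          using p(1-3) hk by (simp add: word_simps)
      qed
    qed
    then show ?thesis
      by (simp add: bij_betw_same_card)
  qed
  have "card H * card K = (\<Sum>p\<in>H \<times> K. 1)"
    by (simp add: card_cartesian_product)
  also have "\<dots> = (\<Sum>z\<in>H <#> K. \<Sum>p\<in>{p \<in> H \<times> K. ?f p = z}. 1)"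
    using sum.image_gen[OF fin, of "\<lambda>_. 1::nat" ?f] im by simp
  also have "\<dots> = card (H <#> K) * card (H \<inter> K)"
    using fib by simp
  finally show ?thesis ..
qed

text \<open>Lagrange's theorem inside \<open>K\<close>, with the cosets written as an image so that
  indices of subgroups of \<open>G\<close> can be compared without changing the ambient
  group.\<close>

lemma card_cosets_in_subgroup:
  assumes "subgroup H G" "subgroup K G" "H \<subseteq> K"
  shows "card ((\<lambda>x. H #> x) ` K) * card H = card K"
proof -
  interpret K: group "G\<lparr>carrier := K\<rparr>"
    using assms(2) subgroup_imp_group by blast
  have "subgroup H (G\<lparr>carrier := K\<rparr>)"
    using assms subgroup_incl by blast
  moreover have "rcosets\<^bsub>G\<lparr>carrier := K\<rparr>\<^esub> H = (\<lambda>x. H #> x) ` K"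
    by (auto simp: RCOSETS_def r_coset_def)
  ultimately show ?thesis
    using K.lagrange[of H] by (simp add: order_def)
qed

text \<open>Every stabilizer contains \<open>K\<close>, so orbit lengths divide the power
  \<open>r ^ b\<close>, and an orbit with more than one point has length divisible by
  \<open>r\<close>. The action is a plain function on \<open>T\<close>, ready for cosets.\<close>

lemma p_power_index_fixed_points:
  assumes Q: "subgroup Q G" and fin: "finite (carrier G)"
    and K: "subgroup K G" "K \<subseteq> Q" and r: "Factorial_Ring.prime (r::nat)" and index: "card Q = card K * r ^ b"
    and T: "finite T"
    and closed: "\<And>a x. a \<in> Q \<Longrightarrow> x \<in> T \<Longrightarrow> act a x \<in> T"
    and one: "\<And>x. x \<in> T \<Longrightarrow> act \<one> x = x"
    and mult: "\<And>a b x. a \<in> Q \<Longrightarrow> b \<in> Q \<Longrightarrow> x \<in> T \<Longrightarrow> act (a \<otimes> b) x = act a (act b x)"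
    and triv: "\<And>k x. k \<in> K \<Longrightarrow> x \<in> T \<Longrightarrow> act k x = x"
  shows "card T mod r = card {x \<in> T. \<forall>a\<in>Q. act a x = x} mod r"
proof -
  interpret Q: subgroup Q G by fact
  let ?Q = "G\<lparr>carrier := Q\<rparr>"
  interpret GQ: group ?Q
    using Q subgroup_imp_group by blast
  \<comment> \<open>\<open>Bij T\<close> contains only functions extensional on \<open>T\<close>,
    hence the restriction.\<close>
  define \<phi> where "\<phi> a = restrict (act a) T" for a
  have bij: "\<phi> a \<in> Bij T" if a: "a \<in> Q" for a
  proof -
    have "act (inv a) (act a x) = x" "act a (act (inv a) x) = x" if "x \<in> T" for x
      using mult[of "inv a" a x] mult[of a "inv a" x] one that a by simp_all
    then have "bij_betw (act a) T T"
      using closed a by (intro bij_betwI[where g = "act (inv a)"]) auto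
    then show ?thesis
      unfolding Bij_def \<phi>_def by (simp cong: bij_betw_cong)
  qed
  have "\<phi> \<in> hom ?Q (BijGroup T)"
  proof (rule homI)
    show "\<phi> a \<in> carrier (BijGroup T)" if "a \<in> carrier ?Q" for a
      using bij that by (simp add: BijGroup_def)
    show "\<phi> (a \<otimes>\<^bsub>?Q\<^esub> b) = \<phi> a \<otimes>\<^bsub>BijGroup T\<^esub> \<phi> b" if "a \<in> carrier ?Q" "b \<in> carrier ?Q" for a b
      using bij that closed mult
      by (auto simp: BijGroup_def \<phi>_def compose_def fun_eq_iff)
  qed
  then interpret act: group_action ?Q T \<phi>
    unfolding group_action_def group_hom_def group_hom_axioms_def
    using GQ.group_axioms group_BijGroup by blast
  let ?F = "{x \<in> T. \<forall>a\<in>Q. act a x = x}"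
  let ?O = "orbits ?Q T \<phi>"
  have orb: "orbit ?Q \<phi> x = (\<lambda>a. act a x) ` Q" if "x \<in> T" for x
    using that by (auto simp: orbit_def \<phi>_def)
  have dvd: "r dvd card (orbit ?Q \<phi> x)" if x: "x \<in> T" "x \<notin> ?F" for x
  proof -
    have st: "subgroup (stabilizer ?Q \<phi> x) ?Q"
      using act.stabilizer_subgroup x by blast
    have "K \<subseteq> stabilizer ?Q \<phi> x"
      using K(2) triv x by (auto simp: stabilizer_def \<phi>_def)
    then have "card K dvd card (stabilizer ?Q \<phi> x)"
      using GQ.card_cosets_in_subgroup[OF subgroup_incl[OF K(1) Q K(2)] st]
      by (metis dvd_triv_right)
    then obtain c where c: "card (stabilizer ?Q \<phi> x) = card K * c" ..
    have "card (orbit ?Q \<phi> x) * card (stabilizer ?Q \<phi> x) = card Q"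
      using act.orbit_stabilizer_theorem x by (simp add: order_def)
    moreover have "card K > 0"
      using subgroup.finite_imp_card_positive[OF K(1) fin] .
    ultimately have "card (orbit ?Q \<phi> x) * c = r ^ b"
      using c index by simp
    then obtain i where i: "card (orbit ?Q \<phi> x) = r ^ i"
      using r by (metis divides_primepow_nat dvd_triv_left)
    have "i \<noteq> 0"
    proof
      assume "i = 0"
      then obtain y where y: "orbit ?Q \<phi> x = {y}"
        using i card_1_singletonE by force
      have "x \<in> orbit ?Q \<phi> x"
        using act.orbit_refl x by blast
      then have "act a x = x" if "a \<in> Q" for a
        using y orb[OF x(1)] that by (metis image_eqI singletonD)
      then show False
        using x by blast
    qed
    then show ?thesis
      using i by simp
  qed
  have "Q \<noteq> {}"
    using Q.one_closed by blast
  have single: "orbit ?Q \<phi> x = {x}" if "x \<in> ?F" for x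
    using orb[of x] that \<open>Q \<noteq> {}\<close> by (simp add: image_constant_conv)
  have O: "?O = (\<lambda>x. {x}) ` ?F \<union> orbit ?Q \<phi> ` (T - ?F)"
  proof -
    have "?O = orbit ?Q \<phi> ` ?F \<union> orbit ?Q \<phi> ` (T - ?F)"
      by (auto simp: orbits_def)
    also have "orbit ?Q \<phi> ` ?F = (\<lambda>x. {x}) ` ?F"
      using single by (intro image_cong) auto
    finally show ?thesis .
  qed
  have disj: "(\<lambda>x. {x}) ` ?F \<inter> orbit ?Q \<phi> ` (T - ?F) = {}"
  proof -
    have False if "x \<in> ?F" "y \<in> T - ?F" "{x} = orbit ?Q \<phi> y" for x y
      using that act.orbit_refl[of y] by auto
    then show ?thesis by blast
  qed
  have "card T = (\<Sum>U\<in>?O. card U)"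
    using act.disjoint_sum[OF T, of "\<lambda>_. 1::nat"] by simp
  also have "\<dots> = (\<Sum>U\<in>(\<lambda>x. {x}) ` ?F. card U) + (\<Sum>U\<in>orbit ?Q \<phi> ` (T - ?F). card U)"
    unfolding O using disj T by (intro sum.union_disjoint) auto
  also have "(\<Sum>U\<in>(\<lambda>x. {x}) ` ?F. card U) = card ?F"
    by (subst sum.reindex) auto
  finally have "card T = card ?F + (\<Sum>U\<in>orbit ?Q \<phi> ` (T - ?F). card U)" .
  moreover have "r dvd (\<Sum>U\<in>orbit ?Q \<phi> ` (T - ?F). card U)"
    using dvd by (intro dvd_sum) auto
  ultimately show ?thesis
    by (elim dvdE) simp
qed

text \<open>For each prime \<open>s\<close> dividing the order, Sylow's theorem with exponent
  \<open>1\<close> gives a subgroup of order \<open>s\<close>. A nontrivial element of it has order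
  dividing both \<open>s\<close> and \<open>r\<close>, which forces \<open>s = r\<close>.\<close>

lemma exponent_prime_imp_order_prime_power:
  assumes fin: "finite (carrier G)" and r: "Factorial_Ring.prime (r::nat)"
    and exponent: "\<And>x. x \<in> carrier G \<Longrightarrow> x [^] r = \<one>"
  shows "\<exists>b. order G = r ^ b"
proof -
  have pos: "order G > 0"
    using fin order_gt_0_iff_finite by blast
  have only: "s = r" if s: "Factorial_Ring.prime s" "s dvd order G" for s
  proof (rule ccontr)
    assume "s \<noteq> r"
    obtain m where "order G = s ^ 1 * m"
      using s(2) by auto
    then obtain S where S: "subgroup S G" "card S = s"
      using sylow_thm[OF s(1) group_axioms _ fin] by fastforce
    interpret S: group "G\<lparr>carrier := S\<rparr>"
      using S(1) subgroup_imp_group by blast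
    have "s \<ge> 2"
      using s(1) prime_ge_2_nat by blast
    then have "S \<noteq> {\<one>}"
      using S(2) by auto
    then obtain x where x: "x \<in> S" "x \<noteq> \<one>"
      using subgroup.one_closed[OF S(1)] by blast
    have xG: "x \<in> carrier G"
      using x(1) S(1) subgroup.mem_carrier by metis
    have "x [^]\<^bsub>G\<lparr>carrier := S\<rparr>\<^esub> order (G\<lparr>carrier := S\<rparr>) = \<one>\<^bsub>G\<lparr>carrier := S\<rparr>\<^esub>"
      using x(1) by (intro S.pow_order_eq_1) simp
    then have "x [^] s = \<one>"
      using S(2) by (simp add: order_def nat_pow_consistent[symmetric])
    then have "ord x dvd s" "ord x dvd r"
      using exponent[OF xG] xG pow_eq_id by blast+
    moreover have "coprime s r"
      using \<open>s \<noteq> r\<close> s(1) r primes_coprime by blast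
    ultimately have "ord x = 1"
      using coprime_common_divisor_nat by blast
    then show False
      using x(2) xG ord_eq_1 by blast
  qed
  have "order G = r ^ multiplicity r (order G)"
  proof -
    obtain m where m: "order G = r ^ multiplicity r (order G) * m" "\<not> r dvd m"
      using multiplicity_decompose'[of "order G" r] pos r not_prime_unit by blast
    have "m = 1"
    proof (rule ccontr)
      assume "m \<noteq> 1"
      then obtain s where s: "Factorial_Ring.prime s" "s dvd m"
        using prime_factor_nat by blast
      then have "s dvd order G"
        by (subst m(1)) simp
      then show False
        using only[OF s(1)] s(2) m(2) by simp
    qed
    then show ?thesis
      using m(1) by simp
  qed
  then show ?thesis ..
qed

end

section \<open>Abelian chief factors\<close>

text \<open>For normal \<open>L\<close> this is the preimage in \<open>G\<close> of the centralizer
  of the image of \<open>S\<close> in \<open>G/L\<close>. Stating it by commutators keeps the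
  argument inside \<open>G\<close>.\<close>

definition centralizer_mod :: "('a, 'b) monoid_scheme \<Rightarrow> 'a set \<Rightarrow> 'a set \<Rightarrow> 'a set" where
  "centralizer_mod G S L =
     {g \<in> carrier G. \<forall>s\<in>S. g \<otimes>\<^bsub>G\<^esub> s \<otimes>\<^bsub>G\<^esub> inv\<^bsub>G\<^esub> g \<otimes>\<^bsub>G\<^esub> inv\<^bsub>G\<^esub> s \<in> L}"

text \<open>The centralizer clause says that \<open>N/L\<close> is abelian; the last clause, with
  \<open>L \<subset> N\<close>, says that \<open>N/L\<close> is a minimal normal subgroup of
  \<open>G/L\<close>.\<close>

definition abelian_chief_factor :: "('a, 'b) monoid_scheme \<Rightarrow> 'a set \<Rightarrow> 'a set \<Rightarrow> bool" where
  "abelian_chief_factor G N L \<longleftrightarrow> N \<lhd> G \<and> L \<lhd> G \<and> L \<subset> N \<and> N \<subseteq> centralizer_mod G N L \<and>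
     (\<forall>Y. Y \<lhd> G \<and> L \<subseteq> Y \<and> Y \<subseteq> N \<longrightarrow> Y = L \<or> Y = N)"

context group
begin

text \<open>Writing \<open>[g,s]\<close> for the commutator of the definition, \<open>[gh,s]\<close>
  is the product of a conjugate of \<open>[h,s]\<close> with \<open>[g,s]\<close>, and
  \<open>[inv g,s]\<close> is a conjugate of the inverse of \<open>[g,s]\<close>. For a conjugate of
  \<open>g\<close> by \<open>x\<close>, normality of \<open>S\<close> allows \<open>s\<close> to be
  conjugated back first.\<close>

lemma centralizer_mod_normal:
  assumes "S \<lhd> G" "L \<lhd> G"
  shows "centralizer_mod G S L \<lhd> G"
proof -
  interpret S: normal S G by fact
  interpret L: normal L G by fact
  let ?C = "centralizer_mod G S L"
  have comm: "g \<otimes> s \<otimes> inv g \<otimes> inv s \<in> L" if "g \<in> ?C" "s \<in> S" for g s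
    using that by (auto simp: centralizer_mod_def)
  have car: "g \<in> carrier G" if "g \<in> ?C" for g
    using that by (auto simp: centralizer_mod_def)
  show ?thesis
  proof (rule normal_invI[OF subgroupI])
    show "?C \<subseteq> carrier G" "?C \<noteq> {}"
      by (auto simp: centralizer_mod_def intro!: exI[of _ \<one>])
  next
    fix g assume g: "g \<in> ?C"
    have "inv g \<otimes> s \<otimes> inv (inv g) \<otimes> inv s \<in> L" if s: "s \<in> S" for s
    proof -
      have "inv g \<otimes> inv (g \<otimes> s \<otimes> inv g \<otimes> inv s) \<otimes> g \<in> L"
        using comm[OF g s] L.inv_op_closed1 car[OF g] by simp
      moreover have "inv g \<otimes> inv (g \<otimes> s \<otimes> inv g \<otimes> inv s) \<otimes> g = inv g \<otimes> s \<otimes> inv (inv g) \<otimes> inv s"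
        using car[OF g] s by (simp add: word_simps)
      ultimately show ?thesis by simp
    qed
    then show "inv g \<in> ?C"
      using car[OF g] by (simp add: centralizer_mod_def)
  next
    fix g h assume g: "g \<in> ?C" and h: "h \<in> ?C"
    have "g \<otimes> h \<otimes> s \<otimes> inv (g \<otimes> h) \<otimes> inv s \<in> L" if s: "s \<in> S" for s
    proof -
      have "(g \<otimes> (h \<otimes> s \<otimes> inv h \<otimes> inv s) \<otimes> inv g) \<otimes> (g \<otimes> s \<otimes> inv g \<otimes> inv s) \<in> L"
        using comm[OF g s] comm[OF h s] L.inv_op_closed2 car[OF g] by simp
      moreover have "(g \<otimes> (h \<otimes> s \<otimes> inv h \<otimes> inv s) \<otimes> inv g) \<otimes> (g \<otimes> s \<otimes> inv g \<otimes> inv s)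
          = g \<otimes> h \<otimes> s \<otimes> inv (g \<otimes> h) \<otimes> inv s"
        using car[OF g] car[OF h] s by (simp add: word_simps)
      ultimately show ?thesis by simp
    qed
    then show "g \<otimes> h \<in> ?C"
      using car[OF g] car[OF h] by (simp add: centralizer_mod_def)
  next
    fix x g assume x: "x \<in> carrier G" and g: "g \<in> ?C"
    have "x \<otimes> g \<otimes> inv x \<otimes> s \<otimes> inv (x \<otimes> g \<otimes> inv x) \<otimes> inv s \<in> L" if s: "s \<in> S" for s
    proof -
      let ?s = "inv x \<otimes> s \<otimes> x"
      have "?s \<in> S"
        using s x S.inv_op_closed1 by blast
      then have "x \<otimes> (g \<otimes> ?s \<otimes> inv g \<otimes> inv ?s) \<otimes> inv x \<in> L"
        using comm[OF g] L.inv_op_closed2 x by blast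
      moreover have "x \<otimes> (g \<otimes> ?s \<otimes> inv g \<otimes> inv ?s) \<otimes> inv x
          = x \<otimes> g \<otimes> inv x \<otimes> s \<otimes> inv (x \<otimes> g \<otimes> inv x) \<otimes> inv s"
        using car[OF g] x s by (simp add: word_simps)
      ultimately show ?thesis by simp
    qed
    then show "x \<otimes> g \<otimes> inv x \<in> ?C"
      using car[OF g] x by (simp add: centralizer_mod_def)
  qed
qed

text \<open>The commutator of \<open>a\<close> and \<open>b\<close> is the inverse of that of
  \<open>b\<close> and \<open>a\<close>.\<close>

lemma subset_centralizer_mod_sym:
  assumes "A \<subseteq> carrier G" "B \<subseteq> centralizer_mod G A L" "subgroup L G"
  shows "A \<subseteq> centralizer_mod G B L"
proof
  fix a assume a: "a \<in> A"
  have "a \<otimes> b \<otimes> inv a \<otimes> inv b \<in> L" if b: "b \<in> B" for b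
  proof -
    have "b \<in> carrier G" "b \<otimes> a \<otimes> inv b \<otimes> inv a \<in> L"
      using assms(2) a b by (auto simp: centralizer_mod_def)
    moreover then have "inv (b \<otimes> a \<otimes> inv b \<otimes> inv a) = a \<otimes> b \<otimes> inv a \<otimes> inv b"
      using a assms(1) by (simp add: word_simps subsetD)
    ultimately show ?thesis
      using subgroup.m_inv_closed[OF assms(3)] by metis
  qed
  then show "a \<in> centralizer_mod G B L"
    using a assms(1) by (auto simp: centralizer_mod_def)
qed

lemma derived_subset_imp_centralizer_mod:
  assumes "N \<subseteq> carrier G" "derived G N \<subseteq> L"
  shows "N \<subseteq> centralizer_mod G N L"
proof
  fix x assume x: "x \<in> N"
  have "x \<otimes> y \<otimes> inv x \<otimes> inv y \<in> L" if "y \<in> N" for y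
    using x that assms(2) generate.incl[of "x \<otimes> y \<otimes> inv x \<otimes> inv y" "derived_set G N" G]
    unfolding derived_def by blast
  then show "x \<in> centralizer_mod G N L"
    using x assms(1) by (auto simp: centralizer_mod_def)
qed

text \<open>The last term of the derived series not inside \<open>H\<close> is abelian modulo \<open>H\<close>; a minimal
  normal subgroup of \<open>G\<close> among those inside it but not inside \<open>H\<close> is the top of the chief factor.\<close>

lemma solvable_abelian_chief_factor_outside_subgroup:
  assumes fin: "finite (carrier G)" and solv: "solvable G"
    and H: "subgroup H G" "H \<noteq> carrier G"
  obtains N L where "abelian_chief_factor G N L" "L \<subseteq> H" "\<not> N \<subseteq> H"
proof -
  let ?D = "\<lambda>i. (derived G ^^ i) (carrier G)"
  interpret H: subgroup H G by fact
  obtain n where "?D n = {\<one>}"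
    using solv solvable_iff_trivial_derived_seq by blast
  then have n: "?D n \<subseteq> H" by simp
  moreover have "\<not> ?D 0 \<subseteq> H"
    using H H.subset by auto
  ultimately obtain i where i: "\<not> ?D i \<subseteq> H" "?D (Suc i) \<subseteq> H"
    using inc_induct[of 0 n "\<lambda>i. ?D i \<subseteq> H"] by blast
  have Dnormal: "?D j \<lhd> G" for j
    by (induction j) (auto simp: normal_self derived_is_normal)
  define P where "P = (\<lambda>N. N \<lhd> G \<and> N \<subseteq> ?D i \<and> \<not> N \<subseteq> H)"
  have "P (?D i)"
    using Dnormal i by (simp add: P_def)
  then obtain N where N: "P N" and min: "\<And>Y. P Y \<Longrightarrow> card N \<le> card Y"
    using arg_min_natI[of P _ card] arg_min_nat_le[of P _ card] by metis
  interpret N: normal N G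
    using N by (simp add: P_def)
  \<comment> \<open>\<open>L\<close> is the normal core of \<open>N \<inter> H\<close> in
    \<open>G\<close>, the largest normal subgroup of \<open>G\<close> inside it; the fact
    \<open>max\<close> records this.\<close>
  define L where "L = {x \<in> N. \<forall>g\<in>carrier G. g \<otimes> x \<otimes> inv g \<in> H}"
  have LH: "L \<subseteq> H"
  proof
    fix x assume x: "x \<in> L"
    then have "\<one> \<otimes> x \<otimes> inv \<one> \<in> H"
      unfolding L_def by blast
    then show "x \<in> H"
      using x by (simp add: L_def)
  qed
  have L: "L \<lhd> G"
  proof (rule normal_invI[OF subgroupI])
    show "L \<subseteq> carrier G"
      using N.subset by (auto simp: L_def)
    show "L \<noteq> {}"
      by (auto simp: L_def intro!: exI[of _ \<one>])
  next
    fix x assume x: "x \<in> L"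
    have "g \<otimes> inv x \<otimes> inv g \<in> H" if g: "g \<in> carrier G" for g
    proof -
      have "inv (g \<otimes> x \<otimes> inv g) \<in> H"
        using x g by (simp add: L_def)
      then show ?thesis
        using x g by (simp add: L_def word_simps)
    qed
    then show "inv x \<in> L"
      using x by (simp add: L_def)
  next
    fix x y assume x: "x \<in> L" and y: "y \<in> L"
    have "g \<otimes> (x \<otimes> y) \<otimes> inv g \<in> H" if g: "g \<in> carrier G" for g
    proof -
      have "(g \<otimes> x \<otimes> inv g) \<otimes> (g \<otimes> y \<otimes> inv g) \<in> H"
        using x y g by (simp add: L_def)
      then show ?thesis
        using x y g by (simp add: L_def word_simps)
    qed
    then show "x \<otimes> y \<in> L"
      using x y by (simp add: L_def)
  next
    fix h x assume h: "h \<in> carrier G" and x: "x \<in> L"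
    have "g \<otimes> (h \<otimes> x \<otimes> inv h) \<otimes> inv g \<in> H" if g: "g \<in> carrier G" for g
    proof -
      have "(g \<otimes> h) \<otimes> x \<otimes> inv (g \<otimes> h) \<in> H"
        using x g h by (simp add: L_def)
      then show ?thesis
        using x g h by (simp add: L_def word_simps)
    qed
    then show "h \<otimes> x \<otimes> inv h \<in> L"
      using x h N.inv_op_closed2 by (simp add: L_def)
  qed
  have max: "Y \<subseteq> L" if Y: "Y \<lhd> G" "Y \<subseteq> N" "Y \<subseteq> H" for Y
  proof
    fix x assume "x \<in> Y"
    then show "x \<in> L"
      using Y normal.inv_op_closed2[OF Y(1)] by (auto simp: L_def)
  qed
  \<comment> \<open>The derived subgroup of \<open>N\<close> lies in the next term of the derived
    series, hence in \<open>H\<close>; being normal in \<open>G\<close>, it falls into the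
    core.\<close>
  have "derived G N \<subseteq> L"
  proof (rule max)
    show "derived G N \<lhd> G"
      using N.normal_axioms derived_is_normal by blast
    show "derived G N \<subseteq> N"
      using derived_incl N.subgroup_axioms by blast
    have "derived G N \<subseteq> derived G (?D i)"
      using N by (intro mono_derived) (simp add: P_def)
    then show "derived G N \<subseteq> H"
      using i by auto
  qed
  then have "N \<subseteq> centralizer_mod G N L"
    using derived_subset_imp_centralizer_mod N.subset by blast
  moreover have "L \<subset> N"
    using LH N by (auto simp: P_def L_def)
  moreover have "Y = L \<or> Y = N" if Y: "Y \<lhd> G" "L \<subseteq> Y" "Y \<subseteq> N" for Y
  proof (cases "Y \<subseteq> H")
    case True
    then show ?thesis using max Y by blast
  next
    case False
    then have "P Y"
      using Y N by (auto simp: P_def)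
    then have "card N \<le> card Y" by (rule min)
    moreover have "finite N"
      using fin N.subset finite_subset by blast
    ultimately show ?thesis
      using Y card_seteq by blast
  qed
  ultimately have "abelian_chief_factor G N L"
    using L N.normal_axioms by (auto simp: abelian_chief_factor_def)
  then show thesis
    using that LH N by (auto simp: P_def)
qed

text \<open>Take a prime \<open>r\<close> dividing \<open>|N : L|\<close>. The elements of
  \<open>N\<close> whose \<open>r\<close>-th power lies in \<open>L\<close> form a normal subgroup
  of \<open>G\<close>, which is larger than \<open>L\<close> by Cauchy's theorem and therefore
  equals \<open>N\<close>. So \<open>N/L\<close> has exponent \<open>r\<close>.\<close>

lemma abelian_chief_factor_prime_power:
  assumes fin: "finite (carrier G)" and chief: "abelian_chief_factor G N L"
  obtains r b where "Factorial_Ring.prime (r::nat)" "card N = card L * r ^ b"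
proof -
  interpret N: normal N G
    using chief by (simp add: abelian_chief_factor_def)
  interpret L: normal L G
    using chief by (simp add: abelian_chief_factor_def)
  have LN: "L \<subset> N" and abel: "N \<subseteq> centralizer_mod G N L"
    and minimal: "\<And>Y. Y \<lhd> G \<Longrightarrow> L \<subseteq> Y \<Longrightarrow> Y \<subseteq> N \<Longrightarrow> Y = L \<or> Y = N"
    using chief by (auto simp: abelian_chief_factor_def)
  define Q where "Q = G Mod L"
  define V where "V = (\<lambda>x. L #> x) ` N"
  interpret Q: group Q
    unfolding Q_def by (rule L.factorgroup_is_group)
  have hom: "(\<lambda>x. L #> x) \<in> hom G Q"
    unfolding Q_def by (rule L.r_coset_hom_Mod)
  then interpret h: group_hom G Q "\<lambda>x. L #> x"
    by unfold_locales
  have Vsub: "subgroup V Q"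
    unfolding V_def by (rule h.subgroup_img_is_subgroup[OF N.subgroup_axioms])
  let ?V = "Q\<lparr>carrier := V\<rparr>"
  interpret V: group ?V
    using Vsub Q.subgroup_imp_group by blast
  have comm: "(L #> x) \<otimes>\<^bsub>Q\<^esub> (L #> y) = (L #> y) \<otimes>\<^bsub>Q\<^esub> (L #> x)" if "x \<in> N" "y \<in> N" for x y
  proof -
    have "x \<otimes> y \<otimes> inv x \<otimes> inv y \<in> L"
      using that abel by (auto simp: centralizer_mod_def)
    then have "L #> (x \<otimes> y \<otimes> inv x \<otimes> inv y) \<otimes> (y \<otimes> x) = L #> (y \<otimes> x)"
      using that by (simp add: coset_mult_assoc[symmetric] L.subset coset_join2 L.subgroup_axioms)
    moreover have "(x \<otimes> y \<otimes> inv x \<otimes> inv y) \<otimes> (y \<otimes> x) = x \<otimes> y"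
      using that by (simp add: word_simps)
    ultimately show ?thesis
      using that by (simp flip: h.hom_mult)
  qed
  interpret V: comm_group ?V
    by (rule V.group_comm_groupI) (auto simp: V_def comm)
  have finV: "finite (carrier ?V)"
    using fin N.subset finite_subset by (auto simp: V_def)
  have ordV: "order ?V * card L = card N"
    using card_cosets_in_subgroup[OF L.subgroup_axioms N.subgroup_axioms] LN
    by (simp add: order_def V_def psubset_imp_subset)
  have "finite N"
    using fin N.subset finite_subset by blast
  then have "card L < card N"
    using LN psubset_card_mono by blast
  then have "order ?V \<noteq> 1"
    using ordV by auto
  then obtain r m where r: "Factorial_Ring.prime r" and "order ?V = r * m"
    using prime_factor_nat by (metis dvdE)
  then obtain S where S: "subgroup S ?V" "card S = r"
    using sylow_thm[OF r V.group_axioms _ finV, of 1] by auto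
  have pow: "(L #> x) [^]\<^bsub>?V\<^esub> (k::nat) = L #> (x [^] k)" if "x \<in> N" for x k
    using that L.FactGroup_pow[of x k] by (simp add: Q_def nat_pow_def)
  have one: "\<one>\<^bsub>Q\<^esub> = L"
    by (simp add: Q_def)
  define Y where "Y = {x \<in> N. x [^] r \<in> L}"
  \<comment> \<open>Membership in \<open>Y\<close> is read off in the abelian quotient
    \<open>V\<close>, where powers distribute over products; this gives closure of \<open>Y\<close>
    under multiplication.\<close>
  have Yiff: "x [^] r \<in> L \<longleftrightarrow> (L #> x) [^]\<^bsub>?V\<^esub> r = \<one>\<^bsub>?V\<^esub>" if "x \<in> N" for x
    using that L.subgroup_axioms coset_join1[of L "x [^] r"] coset_join2[of "x [^] r" L]
    by (auto simp: pow one)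
  have inV: "L #> x \<in> carrier ?V" if "x \<in> N" for x
    using that by (simp add: V_def)
  have conj_pow: "(g \<otimes> x \<otimes> inv g) [^] (k::nat) = g \<otimes> x [^] k \<otimes> inv g"
    if "g \<in> carrier G" "x \<in> carrier G" for g x k
    using that by (induction k) (simp_all add: word_simps)
  have "Y \<lhd> G"
  proof (rule normal_invI[OF subgroupI])
    show "Y \<subseteq> carrier G" "Y \<noteq> {}"
      using N.subset by (auto simp: Y_def intro!: exI[of _ \<one>])
  next
    fix x assume "x \<in> Y"
    then show "inv x \<in> Y"
      by (simp add: Y_def nat_pow_inv)
  next
    fix x y assume "x \<in> Y" "y \<in> Y"
    then have xy: "x \<in> N" "y \<in> N" "(L #> x) [^]\<^bsub>?V\<^esub> r = \<one>\<^bsub>?V\<^esub>" "(L #> y) [^]\<^bsub>?V\<^esub> r = \<one>\<^bsub>?V\<^esub>"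
      using Yiff by (auto simp: Y_def)
    have "L #> (x \<otimes> y) = (L #> x) \<otimes>\<^bsub>?V\<^esub> (L #> y)"
      using xy by simp
    then have "(L #> (x \<otimes> y)) [^]\<^bsub>?V\<^esub> r = \<one>\<^bsub>?V\<^esub>"
      using V.pow_mult_distrib[OF V.m_comm[OF inV[OF xy(1)] inV[OF xy(2)]] inV[OF xy(1)] inV[OF xy(2)], of r]
        xy(3,4) by simp
    then show "x \<otimes> y \<in> Y"
      using xy(1,2) Yiff[of "x \<otimes> y"] by (simp add: Y_def)
  next
    fix g x assume "g \<in> carrier G" "x \<in> Y"
    then show "g \<otimes> x \<otimes> inv g \<in> Y"
      by (auto simp: Y_def conj_pow L.inv_op_closed2 N.inv_op_closed2)
  qed
  moreover have "L \<subseteq> Y"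
  proof
    fix x assume "x \<in> L"
    moreover then have "x [^] k \<in> L" for k :: nat
      by (induction k) auto
    ultimately show "x \<in> Y"
      using LN by (auto simp: Y_def)
  qed
  moreover have "Y \<noteq> L"
  proof -
    interpret S: group "?V\<lparr>carrier := S\<rparr>"
      using S(1) V.subgroup_imp_group by blast
    have "S \<noteq> {\<one>\<^bsub>?V\<^esub>}"
      using S(2) r by auto
    then obtain v where v: "v \<in> S" "v \<noteq> \<one>\<^bsub>?V\<^esub>"
      using subgroup.one_closed[OF S(1)] by blast
    then have "v \<in> V"
      using subgroup.subset[OF S(1)] by auto
    then obtain x where x: "x \<in> N" "v = L #> x"
      by (auto simp: V_def)
    have "v [^]\<^bsub>?V\<lparr>carrier := S\<rparr>\<^esub> order (?V\<lparr>carrier := S\<rparr>) = \<one>\<^bsub>?V\<lparr>carrier := S\<rparr>\<^esub>"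
      using v(1) by (intro S.pow_order_eq_1) simp
    then have "v [^]\<^bsub>?V\<^esub> r = \<one>\<^bsub>?V\<^esub>"
      using S(2) by (simp add: order_def nat_pow_def)
    then have "x \<in> Y"
      using x Yiff by (simp add: Y_def)
    moreover have "x \<notin> L"
      using v(2) x one coset_join2[of x L] L.subgroup_axioms by auto
    ultimately show ?thesis by blast
  qed
  ultimately have "Y = N"
    using minimal by (auto simp: Y_def)
  then have "v [^]\<^bsub>?V\<^esub> r = \<one>\<^bsub>?V\<^esub>" if "v \<in> carrier ?V" for v
    using that Yiff by (auto simp: V_def Y_def)
  then obtain b where "order ?V = r ^ b"
    using V.exponent_prime_imp_order_prime_power[OF finV r] by blast
  then show thesis
    using that r ordV by (metis mult.commute)
qed

section \<open>Supplements of a chief factor\<close>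

lemma set_mult_normal_subgroup:
  assumes "subgroup H G" "N \<lhd> G"
  shows "subgroup (H <#> N) G"
  using assms mult_norm_subgroup commut_normal by metis

lemma subset_set_mult:
  assumes "subgroup H G" "subgroup K G"
  shows "H \<subseteq> H <#> K" "K \<subseteq> H <#> K"
proof -
  interpret H: subgroup H G by fact
  interpret K: subgroup K G by fact
  show "H \<subseteq> H <#> K"
  proof
    fix x assume "x \<in> H"
    then have "x = x \<otimes> \<one>" by simp
    then show "x \<in> H <#> K"
      using \<open>x \<in> H\<close> K.one_closed unfolding set_mult_def by blast
  qed
  show "K \<subseteq> H <#> K"
  proof
    fix x assume "x \<in> K"
    then have "x = \<one> \<otimes> x" by simp
    then show "x \<in> H <#> K"
      using \<open>x \<in> K\<close> H.one_closed unfolding set_mult_def by blast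
  qed
qed

lemma set_mult_subset:
  assumes "subgroup U G" "H \<subseteq> U" "K \<subseteq> U"
  shows "H <#> K \<subseteq> U"
  using assms subgroup.m_closed[OF assms(1)] by (auto simp: set_mult_def)

text \<open>Cuts a supplement \<open>M\<close> of \<open>N\<close> down to a supplement of
  \<open>N\<close> in \<open>A\<close>: if \<open>a = m \<otimes> n\<close>, then
  \<open>m = a \<otimes> inv n\<close> lies in \<open>A\<close>.\<close>

lemma dedekind_modular:
  assumes "subgroup M G" "subgroup N G" "subgroup A G" "N \<subseteq> A" "A \<subseteq> M <#> N"
  shows "(M \<inter> A) <#> N = A"
proof
  interpret M: subgroup M G by fact
  interpret N: subgroup N G by fact
  interpret A: subgroup A G by fact
  show "(M \<inter> A) <#> N \<subseteq> A"
    using assms(3,4) set_mult_subset by blast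
  show "A \<subseteq> (M \<inter> A) <#> N"
  proof
    fix a assume a: "a \<in> A"
    then obtain m n where mn: "m \<in> M" "n \<in> N" "a = m \<otimes> n"
      using assms(5) by (auto simp: set_mult_def)
    then have "m = a \<otimes> inv n"
      by (simp add: word_simps)
    then have "m \<in> A"
      using a mn(2) assms(4) by (metis A.m_closed A.m_inv_closed subsetD)
    then show "a \<in> (M \<inter> A) <#> N"
      using mn unfolding set_mult_def by blast
  qed
qed

lemma maximal_set_mult_normal:
  assumes M: "maximal_subgroup M G" and N: "N \<lhd> G" "\<not> N \<subseteq> M"
  shows "M <#> N = carrier G"
proof -
  have sub: "subgroup M G" "subgroup N G"
    using M N normal_imp_subgroup by (auto simp: maximal_subgroup_def)
  have "M \<subseteq> M <#> N" "N \<subseteq> M <#> N"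
    using subset_set_mult[OF sub] by auto
  moreover have "subgroup (M <#> N) G"
    using set_mult_normal_subgroup sub N by blast
  ultimately show ?thesis
    using M N(2) unfolding maximal_subgroup_def by blast
qed

section \<open>Normality of intersections with maximal supplements\<close>

lemma normalI_of_set_mult_eq_carrier:
  assumes M: "subgroup M G" and MN: "M <#> N = carrier G" and N: "N \<subseteq> carrier G"
    and K: "subgroup K G"
    and conjM: "\<And>m x. m \<in> M \<Longrightarrow> x \<in> K \<Longrightarrow> m \<otimes> x \<otimes> inv m \<in> K"
    and conjN: "\<And>n x. n \<in> N \<Longrightarrow> x \<in> K \<Longrightarrow> n \<otimes> x \<otimes> inv n \<in> K"
  shows "K \<lhd> G"
proof (rule normal_invI[OF K])
  fix g x assume "g \<in> carrier G" and x: "x \<in> K"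
  then have "g \<in> M <#> N"
    using MN by simp
  then obtain m n where mn: "m \<in> M" "n \<in> N" "g = m \<otimes> n"
    by (auto simp: set_mult_def)
  then have "m \<otimes> (n \<otimes> x \<otimes> inv n) \<otimes> inv m \<in> K"
    using x conjM conjN by blast
  moreover have "m \<otimes> (n \<otimes> x \<otimes> inv n) \<otimes> inv m = g \<otimes> x \<otimes> inv g"
    using mn x subgroup.mem_carrier[OF M] subgroup.mem_carrier[OF K] N
    by (simp add: word_simps subsetD)
  ultimately show "g \<otimes> x \<otimes> inv g \<in> K" by simp
qed

text \<open>A conjugate of \<open>x\<close> by \<open>n\<close> differs from \<open>x\<close> by a
  commutator in \<open>L\<close>, and \<open>L\<close> lies in \<open>K\<close>. Hence
  \<open>N\<close> normalizes the subgroups between \<open>L\<close> and its centralizer modulo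
  \<open>L\<close>.\<close>

lemma centralizer_mod_conj:
  assumes "L \<subseteq> K" "subgroup K G" "x \<in> K" "x \<in> centralizer_mod G N L" "n \<in> N" "N \<subseteq> carrier G"
    "subgroup L G"
  shows "n \<otimes> x \<otimes> inv n \<in> K"
proof -
  interpret K: subgroup K G by fact
  have n: "n \<in> carrier G"
    using assms by blast
  have "x \<otimes> n \<otimes> inv x \<otimes> inv n \<in> L"
    using assms(4,5) by (auto simp: centralizer_mod_def)
  then have "inv (x \<otimes> n \<otimes> inv x \<otimes> inv n) \<otimes> x \<in> K"
    using assms(1,3) by auto
  moreover have "inv (x \<otimes> n \<otimes> inv x \<otimes> inv n) \<otimes> x = n \<otimes> x \<otimes> inv n"
    using n assms(3) by (simp add: word_simps)
  ultimately show ?thesis by simp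
qed

text \<open>\<open>M\<close> normalizes \<open>M \<inter> C\<close> because \<open>C\<close> is
  normal, \<open>N\<close> normalizes it because \<open>C\<close> centralizes \<open>N\<close>
  modulo \<open>L\<close>, and \<open>M <#> N\<close> is the whole group. The lemma is applied with
  \<open>C = N\<close> and with \<open>C\<close> the full centralizer.\<close>

lemma maximal_supplement_Int_normal:
  assumes chief: "abelian_chief_factor G N L"
    and M: "maximal_subgroup M G" "L \<subseteq> M" "\<not> N \<subseteq> M"
    and C: "C \<lhd> G" "N \<subseteq> C" "C \<subseteq> centralizer_mod G N L"
  shows "M \<inter> C \<lhd> G"
proof -
  have N: "N \<lhd> G" and L: "L \<lhd> G" "L \<subseteq> N"
    using chief by (auto simp: abelian_chief_factor_def)
  have Msub: "subgroup M G"
    using M by (simp add: maximal_subgroup_def)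
  have NG: "N \<subseteq> carrier G"
    using N normal_imp_subgroup subgroup.subset by blast
  have MC: "subgroup (M \<inter> C) G"
    using Msub C normal_imp_subgroup subgroups_Inter_pair by blast
  show ?thesis
  proof (rule normalI_of_set_mult_eq_carrier[OF Msub _ NG MC])
    show "M <#> N = carrier G"
      using maximal_set_mult_normal M N by blast
    show "m \<otimes> x \<otimes> inv m \<in> M \<inter> C" if "m \<in> M" "x \<in> M \<inter> C" for m x
      using that normal.inv_op_closed2[OF C(1), of m x] subgroup.mem_carrier[OF Msub]
        subgroup.m_closed[OF Msub] subgroup.m_inv_closed[OF Msub] by simp
    show "n \<otimes> x \<otimes> inv n \<in> M \<inter> C" if "n \<in> N" "x \<in> M \<inter> C" for n x
    proof (rule centralizer_mod_conj[OF _ MC that(2) _ that(1) NG])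
      show "L \<subseteq> M \<inter> C" "x \<in> centralizer_mod G N L" "subgroup L G"
        using C L M(2) that(2) normal_imp_subgroup by blast+
    qed
  qed
qed

text \<open>By the preceding lemma with \<open>C = N\<close> the intersection is normal in
  \<open>G\<close>, so it is \<open>L\<close> or \<open>N\<close> by the chief factor
  property.\<close>

lemma maximal_supplement_Int:
  assumes chief: "abelian_chief_factor G N L"
    and M: "maximal_subgroup M G" "L \<subseteq> M" "\<not> N \<subseteq> M"
  shows "M \<inter> N = L"
proof -
  have "M \<inter> N \<lhd> G"
    using maximal_supplement_Int_normal[OF chief M, of N] chief by (simp add: abelian_chief_factor_def)
  then have "M \<inter> N = L \<or> M \<inter> N = N"
    using chief M(2) by (auto simp: abelian_chief_factor_def)
  then show ?thesis
    using M(3) by blast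
qed

text \<open>With \<open>q = |N : L|\<close>, all \<open>K\<close> have the same order
  \<open>k = |C| / q\<close>, and any two distinct ones meet in order \<open>k / q\<close>. This
  fixes the first two moments of the number \<open>m x\<close> of complements through
  \<open>x\<close>. On \<open>D\<close> this number is maximal, on the rest of
  \<open>D <#> N\<close> it is zero, and the variance outside \<open>D <#> N\<close> cannot be
  negative, which bounds the number of complements by \<open>k / card D\<close>.\<close>

lemma card_normal_complements_le:
  assumes fin: "finite (carrier G)"
    and N: "N \<lhd> G" and L: "L \<lhd> G" "L \<subset> N"
    and minimal: "\<And>Y. Y \<lhd> G \<Longrightarrow> L \<subseteq> Y \<Longrightarrow> Y \<subseteq> N \<Longrightarrow> Y = L \<or> Y = N"
    and D: "subgroup D G" "L \<subseteq> D"
  shows "card {K. K \<lhd> G \<and> K <#> N = C \<and> K \<inter> N = L \<and> D \<subseteq> K} * card D * card N \<le> card C * card L"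
    (is "card ?K * _ * _ \<le> _")
proof (cases "?K = {}")
  case False
  then obtain K0 where K0: "K0 \<in> ?K" by blast
  interpret N: normal N G by fact
  interpret L: normal L G by fact
  interpret D: subgroup D G by fact
  have sub: "subgroup K G" if "K \<in> ?K" for K
    using that normal_imp_subgroup by blast
  have KC: "K \<subseteq> C" if "K \<in> ?K" for K
    using that subset_set_mult[OF sub[OF that] N.subgroup_axioms] by blast
  have Csub: "subgroup C G"
    using set_mult_normal_subgroup[OF sub[OF K0] N] K0 by simp
  have finC: "finite C"
    using fin subgroup.subset[OF Csub] finite_subset by blast
  have finK: "finite ?K"
    using KC finC by (intro finite_subset[of ?K "Pow C"]) auto
  have Lpos: "card L > 0"
    using L.finite_imp_card_positive fin by blast
  obtain q where q: "card N = q * card L"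
    using card_cosets_in_subgroup[OF L.subgroup_axioms N.subgroup_axioms] L(2) by (metis psubset_imp_subset)
  have "card L < card N"
    using L(2) fin N.subset finite_subset psubset_card_mono by metis
  then have q1: "q > 1"
    using q by (cases "q = 0 \<or> q = 1") auto
  have cardK: "card C = card K * q" if K: "K \<in> ?K" for K
  proof -
    have "card C * card L = card K * card N"
      using card_set_mult[OF sub[OF K] N.subgroup_axioms fin] K by simp
    then show ?thesis
      using q Lpos by simp
  qed
  define k where "k = card K0"
  have k: "card K = k" if "K \<in> ?K" for K
    using cardK[OF that] cardK[OF K0] q1 by (simp add: k_def)
  have meet: "card (K \<inter> K') * q = k" if K: "K \<in> ?K" and K': "K' \<in> ?K" and "K \<noteq> K'" for K K'
  proof -
    have KK: "subgroup (K <#> K') G" "K <#> K' \<lhd> G"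
      using K K' normal_subgroup_set_mult_closed normal_imp_subgroup by blast+
    note inc = subset_set_mult[OF sub[OF K] sub[OF K']]
    have "(K <#> K') \<inter> N \<lhd> G"
      using KK N normal_subgroup_intersect by blast
    moreover have "L \<subseteq> (K <#> K') \<inter> N"
      using K inc by blast
    ultimately have "(K <#> K') \<inter> N = L \<or> (K <#> K') \<inter> N = N"
      using minimal by blast
    \<comment> \<open>Otherwise write \<open>x\<close> in \<open>K'\<close> as
      \<open>a \<otimes> n\<close> with \<open>a\<close> in \<open>K\<close>; then \<open>n\<close>
      lies in \<open>K <#> K'\<close> and in \<open>N\<close>, hence in \<open>L\<close> and in
      \<open>K\<close>. So \<open>K'\<close> is contained in \<open>K\<close>, and equal orders give
      equality.\<close>
    moreover have "(K <#> K') \<inter> N \<noteq> L"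
    proof
      assume eq: "(K <#> K') \<inter> N = L"
      have "K' \<subseteq> K"
      proof
        fix x assume x: "x \<in> K'"
        then have "x \<in> K <#> N"
          using KC[OF K'] K by blast
        then obtain a n where an: "a \<in> K" "n \<in> N" "x = a \<otimes> n"
          by (auto simp: set_mult_def)
        have aG: "a \<in> carrier G"
          using subgroup.mem_carrier[OF sub[OF K]] an by blast
        have "n = inv a \<otimes> x"
          using an aG by (simp add: word_simps)
        moreover have "inv a \<otimes> x \<in> K <#> K'"
          using subgroup.m_inv_closed[OF sub[OF K] an(1)] x by (auto simp: set_mult_def)
        ultimately have "n \<in> K"
          using eq an(2) K by blast
        then show "x \<in> K"
          using an subgroup.m_closed[OF sub[OF K]] by blast
      qed
      moreover have "finite K"
        using KC[OF K] finC finite_subset by blast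
      ultimately show False
        using k[OF K] k[OF K'] \<open>K \<noteq> K'\<close> card_subset_eq by metis
    qed
    \<comment> \<open>The product now contains both \<open>K\<close> and \<open>N\<close>, so it is
      \<open>C\<close>; its order then determines that of \<open>K \<inter> K'\<close>.\<close>
    ultimately have "N \<subseteq> K <#> K'" by blast
    then have "C \<subseteq> K <#> K'"
      using set_mult_subset[OF KK(1) inc(1), of N] K by blast
    moreover have "K <#> K' \<subseteq> C"
      using set_mult_subset[OF Csub KC[OF K] KC[OF K']] .
    ultimately have "card C * card (K \<inter> K') = k * k"
      using card_set_mult[OF sub[OF K] sub[OF K'] fin] k K K' by auto
    moreover have "k > 0"
      using k[OF K] subgroup.finite_imp_card_positive[OF sub[OF K] fin] by simp
    ultimately show ?thesis
      using cardK[OF K] k[OF K] by (simp add: mult.commute)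
  qed
  define E where "E = card ?K"
  have Epos: "E > 0"
    unfolding E_def card_gt_0_iff using K0 finK by blast
  define m where "m x = card {K \<in> ?K. x \<in> K}" for x
  have m_sum: "real (m x) = (\<Sum>K\<in>?K. if x \<in> K then 1 else 0)" for x
    using finK by (simp add: m_def sum.If_cases Int_def conj_commute)
  have sum1: "(\<Sum>x\<in>C. real (m x)) = real E * real k"
  proof -
    have "(\<Sum>x\<in>C. real (m x)) = (\<Sum>K\<in>?K. \<Sum>x\<in>C. if x \<in> K then 1 else 0)"
      unfolding m_sum by (rule sum.swap)
    also have "\<dots> = (\<Sum>K\<in>?K. real k)"
    proof (rule sum.cong[OF refl])
      fix K assume K: "K \<in> ?K"
      then have "C \<inter> K = K"
        using KC by blast
      then show "(\<Sum>x\<in>C. if x \<in> K then 1 else 0) = real k"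
        using finC k[OF K] by (simp add: sum.If_cases)
    qed
    finally show ?thesis
      by (simp add: E_def)
  qed
  \<comment> \<open>The second moment counts ordered pairs of complements through a common point:
    diagonal pairs contribute \<open>k\<close>, all others \<open>k / q\<close>.\<close>
  have sum2: "(\<Sum>x\<in>C. (real (m x))\<^sup>2) = real E * (real k + (real E - 1) * real k / real q)"
  proof -
    have "(\<Sum>x\<in>C. (real (m x))\<^sup>2)
        = (\<Sum>x\<in>C. \<Sum>K\<in>?K. \<Sum>K'\<in>?K. if x \<in> K \<inter> K' then 1 else 0)"
      unfolding m_sum power2_eq_square sum_product
      by (intro sum.cong refl) auto
    also have "\<dots> = (\<Sum>K\<in>?K. \<Sum>x\<in>C. \<Sum>K'\<in>?K. if x \<in> K \<inter> K' then 1 else 0)"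
      by (rule sum.swap)
    also have "\<dots> = (\<Sum>K\<in>?K. \<Sum>K'\<in>?K. \<Sum>x\<in>C. if x \<in> K \<inter> K' then 1 else 0)"
      by (intro sum.cong refl sum.swap)
    also have "\<dots> = (\<Sum>K\<in>?K. \<Sum>K'\<in>?K. if K' = K then real k else real k / real q)"
    proof (intro sum.cong refl)
      fix K K' assume K: "K \<in> ?K" and K': "K' \<in> ?K"
      have "C \<inter> (K \<inter> K') = K \<inter> K'"
        using KC[OF K] by blast
      then have "(\<Sum>x\<in>C. if x \<in> K \<inter> K' then 1 else 0) = real (card (K \<inter> K'))"
        using finC by (subst sum.If_cases) (simp_all add: Collect_conj_eq)
      moreover have "real (card (K \<inter> K')) = real k / real q" if "K' \<noteq> K"
      proof -
        have "real (card (K \<inter> K')) * real q = real k"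
          using meet[OF K K'] that by (metis of_nat_mult)
        then show ?thesis
          using q1 by (simp add: field_simps)
      qed
      ultimately show "(\<Sum>x\<in>C. if x \<in> K \<inter> K' then 1 else 0) = (if K' = K then real k else real k / real q)"
        using k[OF K] by auto
    qed
    also have "\<dots> = (\<Sum>K\<in>?K. real k + (real E - 1) * real k / real q)"
    proof (intro sum.cong refl)
      fix K assume K: "K \<in> ?K"
      have "real (card (?K - {K})) = real E - 1"
        using card_Diff_singleton[OF K] Epos unfolding E_def by (simp add: of_nat_diff)
      have "(\<Sum>K'\<in>?K. if K' = K then real k else real k / real q)
          = real k + (\<Sum>K'\<in>?K - {K}. if K' = K then real k else real k / real q)"
        using sum.remove[OF finK K, of "\<lambda>K'. if K' = K then real k else real k / real q"] by simp
      also have "(\<Sum>K'\<in>?K - {K}. if K' = K then real k else real k / real q)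
          = (\<Sum>K'\<in>?K - {K}. real k / real q)"
        by (intro sum.cong refl) auto
      also have "\<dots> = (real E - 1) * real k / real q"
        using \<open>real (card (?K - {K})) = real E - 1\<close> by (simp only: sum_constant times_divide_eq_right)
      finally show "(\<Sum>K'\<in>?K. if K' = K then real k else real k / real q)
          = real k + (real E - 1) * real k / real q" .
    qed
    finally show ?thesis
      by (simp add: E_def)
  qed
  \<comment> \<open>On \<open>B\<close> the multiplicity takes its two extreme values,
    \<open>E\<close> on \<open>D\<close> and \<open>0\<close> on \<open>B - D\<close>. Splitting
    \<open>B\<close> off is what brings \<open>card D\<close> into the variance estimate.\<close>
  define B where "B = D <#> N"
  have DK0: "D \<subseteq> K0" using K0 by blast
  have DC: "D \<subseteq> C" using DK0 KC[OF K0] by blast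
  have NC: "N \<subseteq> C"
    using subset_set_mult(2)[OF sub[OF K0] N.subgroup_axioms] K0 by blast
  have BC: "B \<subseteq> C"
    unfolding B_def using set_mult_subset[OF Csub DC NC] .
  have DB: "D \<subseteq> B"
    unfolding B_def using subset_set_mult(1)[OF D(1) N.subgroup_axioms] .
  have "D \<inter> N = L"
    using K0 D(2) L(2) by blast
  then have cardB: "card B = card D * q"
    using card_set_mult[OF D(1) N.subgroup_axioms fin] q Lpos unfolding B_def by simp
  have mD: "m x = E" if "x \<in> D" for x
  proof -
    have "{K \<in> ?K. x \<in> K} = ?K"
      using that by blast
    then show ?thesis
      by (simp add: m_def E_def)
  qed
  \<comment> \<open>If \<open>d \<otimes> n\<close> lay in \<open>K\<close>, so would
    \<open>n\<close>; then \<open>n\<close> is in \<open>K \<inter> N = L \<subseteq> D\<close> and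
    the product is already in \<open>D\<close>.\<close>
  have mB: "m x = 0" if x: "x \<in> B - D" for x
  proof -
    obtain d n where dn: "d \<in> D" "n \<in> N" "x = d \<otimes> n"
      using x by (auto simp: B_def set_mult_def)
    have "x \<notin> K" if K: "K \<in> ?K" for K
    proof
      assume "x \<in> K"
      moreover have "inv d \<in> K"
        using dn K by blast
      ultimately have "inv d \<otimes> x \<in> K"
        using subgroup.m_closed[OF sub[OF K]] by blast
      then have "n \<in> K"
        using dn by (simp add: word_simps)
      then have "n \<in> D"
        using dn K D(2) by blast
      then show False
        using dn x by auto
    qed
    then show ?thesis
      unfolding m_def by (metis (mono_tags, lifting) card.empty Collect_empty_eq)
  qed
  have finB: "finite B" "finite D"
    using finite_subset[OF BC finC] finite_subset[OF DC finC] by simp_all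
  have split: "(\<Sum>x\<in>C. f (m x)) = (\<Sum>x\<in>C - B. f (m x)) + (real (card B) - real (card D)) * f 0 + real (card D) * f E"
    for f :: "nat \<Rightarrow> real"
  proof -
    have "(\<Sum>x\<in>C. f (m x)) = (\<Sum>x\<in>C - B. f (m x)) + (\<Sum>x\<in>B. f (m x))"
      using sum.subset_diff[OF BC finC] .
    also have "(\<Sum>x\<in>B. f (m x)) = (\<Sum>x\<in>B - D. f (m x)) + (\<Sum>x\<in>D. f (m x))"
      using sum.subset_diff[OF DB finB(1)] .
    also have "(\<Sum>x\<in>B - D. f (m x)) = real (card (B - D)) * f 0"
      using mB by simp
    also have "(\<Sum>x\<in>D. f (m x)) = real (card D) * f E"
      using mD by simp
    also have "real (card (B - D)) = real (card B) - real (card D)"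
      using DB finB card_mono[OF finB(1) DB] by (simp add: card_Diff_subset of_nat_diff)
    finally show ?thesis by simp
  qed
  define e where "e = real E"
  define Q where "Q = real q"
  define d where "d = real (card D)"
  have Q: "Q > 1" using q1 by (simp add: Q_def)
  have cardCB: "real (card (C - B)) = (real k - d) * Q"
    using BC finB card_mono[OF finC BC] cardB cardK[OF K0] k[OF K0]
    by (simp add: card_Diff_subset of_nat_diff d_def Q_def algebra_simps)
  have s1: "(\<Sum>x\<in>C - B. real (m x)) = e * real k - d * e"
    using split[of real] sum1 by (simp add: e_def d_def)
  have s2: "(\<Sum>x\<in>C - B. (real (m x))\<^sup>2) = e * (real k + (e - 1) * real k / Q) - d * e\<^sup>2"
    using split[of "\<lambda>i. (real i)\<^sup>2"] sum2 by (simp add: e_def d_def Q_def)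
  \<comment> \<open>The variance of the covering multiplicity \<open>m\<close> on \<open>C - B\<close>, where its mean is \<open>e / Q\<close>.\<close>
  have "0 \<le> (\<Sum>x\<in>C - B. (real (m x) - e / Q)\<^sup>2)"
    by (intro sum_nonneg) simp
  also have "\<dots> = (\<Sum>x\<in>C - B. (real (m x))\<^sup>2) - 2 * (e / Q) * (\<Sum>x\<in>C - B. real (m x))
      + real (card (C - B)) * (e / Q)\<^sup>2"
    by (simp add: power2_diff sum.distrib sum_subtractf sum_distrib_left sum_distrib_right mult.assoc mult.commute mult.left_commute)
  \<comment> \<open>The terms with the square of \<open>e\<close> times \<open>k\<close> cancel,
    since the mean on \<open>C - B\<close> is \<open>e / Q\<close>.\<close>
  also have "\<dots> = e * (1 - 1 / Q) * (real k - d * e)"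
    unfolding s1 s2 cardCB using Q by (simp add: field_simps power2_eq_square)
  finally have "0 \<le> e * (1 - 1 / Q) * (real k - d * e)" .
  moreover have "e * (1 - 1 / Q) > 0"
    using Epos Q by (simp add: e_def)
  ultimately have "d * e \<le> real k"
    by (simp add: zero_le_mult_iff)
  then have "card D * E \<le> k"
    unfolding d_def e_def by (metis of_nat_le_iff of_nat_mult)
  then have "E * card D * q * card L \<le> k * q * card L"
    by (simp add: mult.commute)
  then show ?thesis
    using q cardK[OF K0] k[OF K0] by (simp add: E_def mult.assoc mult.commute)
next
  case True
  then show ?thesis
    by (simp only: card.empty mult_0 le0)
qed

section \<open>Conjugacy of supplements\<close>

text \<open>This is the normalizer of \<open>R\<close>, defined by inclusion only: as
  \<open>R\<close> is finite, an injective conjugation of \<open>R\<close> into itself is onto,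
  which supplies closure under inverses.\<close>

lemma conj_stable_subgroup:
  assumes R: "R \<subseteq> carrier G" "finite R"
  shows "subgroup {x \<in> carrier G. \<forall>y\<in>R. x \<otimes> y \<otimes> inv x \<in> R} G" (is "subgroup ?T G")
proof (rule subgroupI)
  show "?T \<subseteq> carrier G" by blast
  have "\<one> \<in> ?T"
    using R by auto
  then show "?T \<noteq> {}" by blast
next
  fix x assume x: "x \<in> ?T"
  then have xG: "x \<in> carrier G" by simp
  have "inj_on (\<lambda>y. x \<otimes> y \<otimes> inv x) R"
    using R xG by (intro inj_onI) (metis inv_closed m_closed r_cancel l_cancel subsetD)
  moreover have "(\<lambda>y. x \<otimes> y \<otimes> inv x) ` R \<subseteq> R"
    using x by blast
  ultimately have surj: "(\<lambda>y. x \<otimes> y \<otimes> inv x) ` R = R"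
    using endo_inj_surj R(2) by blast
  have "inv x \<otimes> y \<otimes> inv (inv x) \<in> R" if y: "y \<in> R" for y
  proof -
    obtain z where z: "z \<in> R" "y = x \<otimes> z \<otimes> inv x"
      using surj y by blast
    then show ?thesis
      using xG R(1) by (simp add: word_simps subsetD)
  qed
  then show "inv x \<in> ?T"
    using xG by simp
next
  fix x y assume x: "x \<in> ?T" and y: "y \<in> ?T"
  have "x \<otimes> y \<otimes> z \<otimes> inv (x \<otimes> y) \<in> R" if z: "z \<in> R" for z
  proof -
    have "x \<otimes> (y \<otimes> z \<otimes> inv y) \<otimes> inv x \<in> R"
      using x y z by blast
    moreover have "x \<otimes> (y \<otimes> z \<otimes> inv y) \<otimes> inv x = x \<otimes> y \<otimes> z \<otimes> inv (x \<otimes> y)"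
      using x y z R(1) by (simp add: word_simps subsetD)
    ultimately show ?thesis by simp
  qed
  then show "x \<otimes> y \<in> ?T"
    using x y by simp
qed

text \<open>Makes conjugation an action on the cosets of \<open>L\<close>, as needed for the fixed
  point count on \<open>N/L\<close>.\<close>

lemma conj_image_rcoset:
  assumes L: "L \<lhd> G" and a: "a \<in> carrier G" and n: "n \<in> carrier G"
  shows "(\<lambda>u. a \<otimes> u \<otimes> inv a) ` (L #> n) = L #> (a \<otimes> n \<otimes> inv a)"
proof -
  interpret L: normal L G by fact
  show ?thesis
  proof (intro equalityI subsetI)
    fix z assume "z \<in> (\<lambda>u. a \<otimes> u \<otimes> inv a) ` (L #> n)"
    then obtain l where l: "l \<in> L" "z = a \<otimes> (l \<otimes> n) \<otimes> inv a"
      by (auto simp: r_coset_def)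
    then have "z = (a \<otimes> l \<otimes> inv a) \<otimes> (a \<otimes> n \<otimes> inv a)"
      using a n by (simp add: word_simps)
    then show "z \<in> L #> (a \<otimes> n \<otimes> inv a)"
      using L.inv_op_closed2[OF a l(1)] unfolding r_coset_def by blast
  next
    fix z assume "z \<in> L #> (a \<otimes> n \<otimes> inv a)"
    then obtain l where l: "l \<in> L" "z = l \<otimes> (a \<otimes> n \<otimes> inv a)"
      by (auto simp: r_coset_def)
    then have "z = a \<otimes> ((inv a \<otimes> l \<otimes> a) \<otimes> n) \<otimes> inv a"
      using a n by (simp add: word_simps)
    then show "z \<in> (\<lambda>u. a \<otimes> u \<otimes> inv a) ` (L #> n)"
      using L.inv_op_closed1[OF a l(1)] unfolding r_coset_def by blast
  qed
qed

text \<open>\<open>A\<close> acts by conjugation on \<open>N/L\<close> with \<open>C_G(N/L)\<close>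
  acting trivially. The fixed points come from a normal subgroup of \<open>G\<close> between
  \<open>L\<close> and \<open>N\<close>; it is not \<open>N\<close>, since \<open>A\<close> is not
  inside the centralizer, so only the trivial coset is fixed. The orbit count then gives
  \<open>q \<equiv> 1\<close> modulo \<open>r\<close>.\<close>

lemma chief_factor_index_coprime:
  assumes fin: "finite (carrier G)" and chief: "abelian_chief_factor G N L"
    and A: "A \<lhd> G" "centralizer_mod G N L \<subset> A" and r: "Factorial_Ring.prime (r::nat)"
    and index: "card A = card (centralizer_mod G N L) * r ^ b"
    and q: "card N = q * card L"
  shows "\<not> r dvd q"
proof -
  interpret N: normal N G
    using chief by (simp add: abelian_chief_factor_def)
  interpret L: normal L G
    using chief by (simp add: abelian_chief_factor_def)
  interpret A: normal A G by fact
  have LN: "L \<subset> N"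
    and minimal: "\<And>Y. Y \<lhd> G \<Longrightarrow> L \<subseteq> Y \<Longrightarrow> Y \<subseteq> N \<Longrightarrow> Y = L \<or> Y = N"
    using chief by (auto simp: abelian_chief_factor_def)
  let ?C = "centralizer_mod G N L"
  have C: "?C \<lhd> G"
    using centralizer_mod_normal N.normal_axioms L.normal_axioms by blast
  let ?Y = "N \<inter> centralizer_mod G A L"
  have "?Y \<lhd> G"
    using centralizer_mod_normal A.normal_axioms L.normal_axioms N.normal_axioms
      normal_subgroup_intersect by blast
  moreover have "L \<subseteq> ?Y"
  proof
    fix l assume l: "l \<in> L"
    have "l \<otimes> a \<otimes> inv l \<otimes> inv a \<in> L" if a: "a \<in> A" for a
    proof -
      have "l \<otimes> (a \<otimes> inv l \<otimes> inv a) \<in> L"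
        using l a L.inv_op_closed2[of a "inv l"] by simp
      then show ?thesis
        using l a by (simp add: word_simps)
    qed
    then show "l \<in> ?Y"
      using l LN by (auto simp: centralizer_mod_def)
  qed
  moreover have "?Y \<noteq> N"
  proof
    assume "?Y = N"
    then have "A \<subseteq> ?C"
      using subset_centralizer_mod_sym[OF A.subset, of N L] L.subgroup_axioms by blast
    then show False
      using A(2) by blast
  qed
  ultimately have Y: "?Y = L"
    using minimal by blast
  define T where "T = (\<lambda>n. L #> n) ` N"
  define act where "act a U = (\<lambda>u. a \<otimes> u \<otimes> inv a) ` U" for a U
  have act: "act a (L #> n) = L #> (a \<otimes> n \<otimes> inv a)" if "a \<in> A" "n \<in> N" for a n
    using that conj_image_rcoset[OF L.normal_axioms] by (simp add: act_def)
  have "card T mod r = card {U \<in> T. \<forall>a\<in>A. act a U = U} mod r"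
  proof (rule p_power_index_fixed_points[OF A.subgroup_axioms fin _ _ r index])
    show "subgroup ?C G" "?C \<subseteq> A"
      using C A(2) normal_imp_subgroup by blast+
    show "finite T"
      using fin N.subset finite_subset unfolding T_def by blast
    show "act a U \<in> T" if a: "a \<in> A" and U: "U \<in> T" for a U
    proof -
      obtain n where n: "n \<in> N" "U = L #> n"
        using U by (auto simp: T_def)
      have "a \<otimes> n \<otimes> inv a \<in> N"
        using N.inv_op_closed2 A.mem_carrier that(1) n(1) by blast
      then show ?thesis
        using act[OF that(1) n(1)] n(2) by (simp add: T_def)
    qed
    show "act \<one> U = U" if "U \<in> T" for U
      using that act[of \<one>] by (auto simp: T_def)
    show "act (a \<otimes> b) U = act a (act b U)" if ab: "a \<in> A" "b \<in> A" and U: "U \<in> T" for a b U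
    proof -
      obtain n where n: "n \<in> N" "U = L #> n"
        using U by (auto simp: T_def)
      have "b \<otimes> n \<otimes> inv b \<in> N"
        using N.inv_op_closed2 A.mem_carrier that(2) n(1) by blast
      then show ?thesis
        using that(1,2) n act by (simp add: word_simps)
    qed
    show "act c U = U" if c: "c \<in> ?C" and U: "U \<in> T" for c U
    proof -
      obtain n where n: "n \<in> N" "U = L #> n"
        using U by (auto simp: T_def)
      have cA: "c \<in> A"
        using c A(2) by blast
      have "c \<otimes> n \<otimes> inv c \<otimes> inv n \<in> L"
        using c n by (auto simp: centralizer_mod_def)
      then have "(c \<otimes> n \<otimes> inv c \<otimes> inv n) \<otimes> n \<in> L #> n"
        unfolding r_coset_def by blast
      then have "c \<otimes> n \<otimes> inv c \<in> L #> n"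
        using cA n by (simp add: word_simps)
      then have "L #> n = L #> (c \<otimes> n \<otimes> inv c)"
        using repr_independence[of "c \<otimes> n \<otimes> inv c" L n] n(1) L.subgroup_axioms by simp
      then show ?thesis
        using act[OF cA n(1)] n(2) by simp
    qed
  qed
  also have "{U \<in> T. \<forall>a\<in>A. act a U = U} = {L}"
  proof
    have "L \<in> T"
      using coset_join2[of \<one> L] L.subgroup_axioms unfolding T_def
      by (intro image_eqI[of _ _ \<one>]) auto
    moreover have "act a L = L" if a: "a \<in> A" for a
      using act[OF a N.one_closed] a L.subset by (simp add: coset_mult_one)
    ultimately show "{L} \<subseteq> {U \<in> T. \<forall>a\<in>A. act a U = U}"
      by blast
    show "{U \<in> T. \<forall>a\<in>A. act a U = U} \<subseteq> {L}"
    proof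
      fix U assume U: "U \<in> {U \<in> T. \<forall>a\<in>A. act a U = U}"
      then obtain n where n: "n \<in> N" "U = L #> n"
        by (auto simp: T_def)
      have "a \<otimes> n \<otimes> inv a \<otimes> inv n \<in> L" if a: "a \<in> A" for a
      proof -
        have "L #> (a \<otimes> n \<otimes> inv a) = L #> n"
          using U n a act[OF a n(1)] by simp
        then have "a \<otimes> n \<otimes> inv a \<in> L #> n"
          using rcos_self[of "a \<otimes> n \<otimes> inv a" L] n a L.subgroup_axioms by simp
        then obtain l where "l \<in> L" "a \<otimes> n \<otimes> inv a = l \<otimes> n"
          by (auto simp: r_coset_def)
        then show ?thesis
          using n by (simp add: word_simps)
      qed
      \<comment> \<open>A fixed coset means that \<open>A\<close> centralizes \<open>n\<close>
        modulo \<open>L\<close>; by symmetry \<open>n\<close> centralizes \<open>A\<close> modulo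
        \<open>L\<close>, so \<open>n\<close> lies in \<open>?Y = L\<close>.\<close>
      then have "A \<subseteq> centralizer_mod G {n} L"
        using A.subset by (auto simp: centralizer_mod_def)
      then have "n \<in> ?Y"
        using subset_centralizer_mod_sym[of "{n}" A L] n(1) L.subgroup_axioms by simp
      then have "n \<in> L"
        using Y by blast
      then show "U \<in> {L}"
        using n coset_join2[of n L] L.subgroup_axioms by simp
    qed
  qed
  finally have "card T mod r = 1 mod r"
    by simp
  moreover have "card L > 0"
    using L.finite_imp_card_positive fin by blast
  then have "card T = q"
    using card_cosets_in_subgroup[OF L.subgroup_axioms N.subgroup_axioms] LN q
    by (simp add: T_def psubset_imp_subset)
  moreover have "r > 1"
    using r prime_gt_1_nat by blast
  ultimately have "q mod r = 1"
    by simp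
  then show ?thesis
    by (simp add: dvd_eq_mod_eq_0)
qed

text \<open>Both \<open>M\<close> and \<open>M0\<close> are normalizers of their intersections with \<open>A\<close>, and these are conjugate
  Sylow subgroups of \<open>A\<close> modulo \<open>K\<close>; conjugacy comes from a fixed point of \<open>M \<inter> A\<close> on the cosets
  of \<open>M0 \<inter> A\<close>.\<close>

lemma maximal_supplements_conjugate:
  assumes fin: "finite (carrier G)" and solv: "solvable G" and chief: "abelian_chief_factor G N L"
    and C: "C = centralizer_mod G N L" "C \<noteq> carrier G"
    and M0: "maximal_subgroup M0 G" "L \<subseteq> M0" "\<not> N \<subseteq> M0"
    and M: "maximal_subgroup M G" "L \<subseteq> M" "\<not> N \<subseteq> M" "M \<inter> C = M0 \<inter> C"
  obtains g where "g \<in> carrier G" "M = (\<lambda>x. inv g \<otimes> x \<otimes> g) ` M0"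
proof -
  interpret N: normal N G
    using chief by (simp add: abelian_chief_factor_def)
  interpret L: normal L G
    using chief by (simp add: abelian_chief_factor_def)
  have LN: "L \<subset> N" and NC: "N \<subseteq> C"
    using chief C(1) by (auto simp: abelian_chief_factor_def)
  have Cn: "C \<lhd> G"
    unfolding C(1) using centralizer_mod_normal N.normal_axioms L.normal_axioms by blast
  interpret C: normal C G by fact
  define K where "K = M0 \<inter> C"
  have Kn: "K \<lhd> G"
    unfolding K_def using maximal_supplement_Int_normal[OF chief M0 Cn NC] C(1) by blast
  interpret K: normal K G by fact
  \<comment> \<open>A second chief factor, taken just above \<open>C\<close>, produces a normal
    subgroup \<open>A = N' <#> C\<close> whose index over \<open>C\<close> is a power of a prime
    \<open>r\<close>.\<close>
  obtain N' L' where N': "abelian_chief_factor G N' L'" "L' \<subseteq> C" "\<not> N' \<subseteq> C"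
    using solvable_abelian_chief_factor_outside_subgroup[OF fin solv C.subgroup_axioms C(2)] by blast
  obtain r b where r: "Factorial_Ring.prime (r::nat)" "card N' = card L' * r ^ b"
    using abelian_chief_factor_prime_power[OF fin N'(1)] by blast
  have N'n: "N' \<lhd> G" "L' \<lhd> G" "L' \<subset> N'"
    using N'(1) by (auto simp: abelian_chief_factor_def)
  have "N' \<inter> C \<lhd> G"
    using N'n Cn normal_subgroup_intersect by blast
  then have N'C: "N' \<inter> C = L'"
    using N' N'n unfolding abelian_chief_factor_def by blast
  define A where "A = N' <#> C"
  have An: "A \<lhd> G"
    unfolding A_def using normal_subgroup_set_mult_closed N'n Cn by blast
  interpret A: normal A G by fact
  have N'sub: "subgroup N' G" "subgroup L' G"
    using N'n normal_imp_subgroup by blast+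
  have CA: "C \<subset> A"
    using subset_set_mult[OF N'sub(1) C.subgroup_axioms] N'(3) unfolding A_def by blast
  have "card A * card L' = card N' * card C"
    using card_set_mult[OF N'sub(1) C.subgroup_axioms fin] N'C unfolding A_def by simp
  moreover have "card L' > 0"
    using subgroup.finite_imp_card_positive[OF N'sub(2) fin] .
  ultimately have cardA: "card A = card C * r ^ b"
    using r(2) by simp
  have Lpos: "card L > 0"
    using L.finite_imp_card_positive fin by blast
  obtain q where q: "card N = q * card L"
    using card_cosets_in_subgroup[OF L.subgroup_axioms N.subgroup_axioms] LN
    by (metis psubset_imp_subset)
  have qpos: "q > 0"
    using q N.finite_imp_card_positive fin by (cases "q = 0") auto
  have rq: "\<not> r dvd q"
    using chief_factor_index_coprime[OF fin chief An _ r(1) _ q, of b] CA cardA C(1) by simp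
  have NA: "N \<subseteq> A"
    using NC CA by blast
  \<comment> \<open>For every supplement \<open>W\<close> in question, Dedekind's law shows that
    \<open>W \<inter> A\<close> and \<open>W \<inter> C\<close> are complements of \<open>N\<close>
    modulo \<open>L\<close> in \<open>A\<close> and in \<open>C\<close>. Hence
    \<open>W \<inter> A\<close> has \<open>r\<close>-power index over \<open>K\<close> and index
    \<open>q\<close> in \<open>A\<close>, and \<open>q\<close> is prime to \<open>r\<close>.\<close>
  have props: "subgroup (W \<inter> A) G \<and> (W \<inter> A) <#> N = A \<and> card A = card (W \<inter> A) * q
      \<and> card (W \<inter> A) = card K * r ^ b \<and> order G = card W * q \<and> K \<subseteq> W \<inter> A"
    if mx: "maximal_subgroup W G" "L \<subseteq> W" "\<not> N \<subseteq> W" "W \<inter> C = K" for W :: "'a set"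
  proof -
    have sub: "subgroup W G"
      using mx by (simp add: maximal_subgroup_def)
    have XA: "subgroup (W \<inter> A) G" and XC: "subgroup (W \<inter> C) G"
      using sub A.subgroup_axioms C.subgroup_axioms subgroups_Inter_pair by blast+
    have XN: "W <#> N = carrier G"
      using maximal_set_mult_normal mx N.normal_axioms by blast
    have int: "W \<inter> N = L"
      using maximal_supplement_Int[OF chief] mx by blast
    have dA: "(W \<inter> A) <#> N = A"
      using dedekind_modular[OF sub N.subgroup_axioms A.subgroup_axioms NA] XN A.subset by simp
    have dC: "(W \<inter> C) <#> N = C"
      using dedekind_modular[OF sub N.subgroup_axioms C.subgroup_axioms NC] XN C.subset by simp
    have intA: "W \<inter> A \<inter> N = L" and intC: "W \<inter> C \<inter> N = L"
      using int NA NC by blast+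
    have "card A * card L = card (W \<inter> A) * card N"
      using card_set_mult[OF XA N.subgroup_axioms fin] dA intA by simp
    then have cA: "card A = card (W \<inter> A) * q"
      using q Lpos by simp
    have "card C * card L = card (W \<inter> C) * card N"
      using card_set_mult[OF XC N.subgroup_axioms fin] dC intC by simp
    then have cC: "card C = card K * q"
      using q Lpos mx(4) by simp
    have "order G * card L = card W * card N"
      using card_set_mult[OF sub N.subgroup_axioms fin] XN int by (simp add: order_def)
    then have "order G = card W * q"
      using q Lpos by simp
    moreover have "card (W \<inter> A) * q = card K * r ^ b * q"
      using cA cC cardA by auto
    then have "card (W \<inter> A) = card K * r ^ b"
      using qpos by simp
    ultimately show ?thesis
      using XA dA cA mx(4) CA by blast
  qed
  define R0 where "R0 = M0 \<inter> A"
  define R where "R = M \<inter> A"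
  have R0: "subgroup R0 G" "card A = card R0 * q" "card R0 = card K * r ^ b" "K \<subseteq> R0"
    and oM0: "order G = card M0 * q"
    using props[OF M0] unfolding R0_def K_def by blast+
  have R: "subgroup R G" "R <#> N = A" "card R = card K * r ^ b" "K \<subseteq> R"
    and oM: "order G = card M * q"
    using props[OF M(1-3)] M(4) unfolding R_def K_def by blast+
  interpret R0: subgroup R0 G by fact
  interpret R: subgroup R G by fact
  have R0A: "R0 \<subseteq> A" and RA: "R \<subseteq> A"
    by (auto simp: R0_def R_def)
  define T where "T = (\<lambda>x. R0 #> x) ` A"
  \<comment> \<open>Right multiplication by the inverse is a left action, in the form required by
    the fixed point lemma.\<close>
  define act where "act a U = U #> inv a" for a U
  have act: "act a (R0 #> x) = R0 #> (x \<otimes> inv a)" if "a \<in> A" "x \<in> A" for a x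
    using that R0.subset by (simp add: act_def coset_mult_assoc)
  have "card T mod r = card {U \<in> T. \<forall>a\<in>R. act a U = U} mod r"
  proof (rule p_power_index_fixed_points[OF R(1) fin K.subgroup_axioms R(4) r(1) R(3)])
    show "finite T"
      using fin A.subset finite_subset unfolding T_def by blast
    show "act a U \<in> T" if a: "a \<in> R" and U: "U \<in> T" for a U
    proof -
      obtain x where x: "x \<in> A" "U = R0 #> x"
        using U by (auto simp: T_def)
      have "a \<in> A"
        using that(1) RA by blast
      then show ?thesis
        using act[of a x] x by (simp add: T_def)
    qed
    show "act \<one> U = U" if "U \<in> T" for U
      using that act[of \<one>] by (auto simp: T_def)
    show "act (a \<otimes> b) U = act a (act b U)" if ab: "a \<in> R" "b \<in> R" and U: "U \<in> T" for a b U
    proof -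
      obtain x where x: "x \<in> A" "U = R0 #> x"
        using U by (auto simp: T_def)
      have "a \<in> A" "b \<in> A"
        using that(1,2) RA by blast+
      then show ?thesis
        using act x by (simp add: word_simps)
    qed
    show "act c U = U" if c: "c \<in> K" and U: "U \<in> T" for c U
    proof -
      obtain x where x: "x \<in> A" "U = R0 #> x"
        using U by (auto simp: T_def)
      have cA: "c \<in> A"
        using c R0(4) R0A by blast
      \<comment> \<open>Normality of \<open>K\<close> in \<open>G\<close> moves \<open>c\<close>
        past \<open>x\<close> into \<open>R0\<close>, so \<open>K\<close> acts trivially on the
        cosets.\<close>
      have "x \<otimes> inv c \<otimes> inv x \<in> R0"
        using K.inv_op_closed2[of x "inv c"] c x R0(4) by auto
      then have "(x \<otimes> inv c \<otimes> inv x) \<otimes> x \<in> R0 #> x"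
        unfolding r_coset_def by blast
      then have "x \<otimes> inv c \<in> R0 #> x"
        using cA x by (simp add: word_simps)
      then have "R0 #> x = R0 #> (x \<otimes> inv c)"
        using repr_independence[of "x \<otimes> inv c" R0 x] x(1) R0(1) by simp
      then show ?thesis
        using act[OF cA x(1)] x(2) by simp
    qed
  qed
  moreover have "card T = q"
    using card_cosets_in_subgroup[OF R0(1) A.subgroup_axioms R0A] R0(2)
      R0.finite_imp_card_positive[OF fin] by (simp add: T_def)
  \<comment> \<open>The number of cosets is \<open>q\<close>, which \<open>r\<close> does not
    divide, so \<open>R\<close> fixes some coset \<open>R0 #> g\<close>; equivalently,
    \<open>g\<close> conjugates \<open>R\<close> into \<open>R0\<close>.\<close>
  ultimately have "card {U \<in> T. \<forall>a\<in>R. act a U = U} mod r \<noteq> 0"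
    using rq by (simp add: dvd_eq_mod_eq_0)
  then have "{U \<in> T. \<forall>a\<in>R. act a U = U} \<noteq> {}"
    by (metis card.empty mod_0)
  then obtain U where U: "U \<in> T" "\<And>a. a \<in> R \<Longrightarrow> act a U = U"
    by blast
  then obtain g where g: "g \<in> A" "U = R0 #> g"
    by (auto simp: T_def)
  have gG: "g \<in> carrier G"
    using g by simp
  have conj: "g \<otimes> a \<otimes> inv g \<in> R0" if a: "a \<in> R" for a
  proof -
    have aA: "inv a \<in> A" "inv a \<in> R"
      using a RA by auto
    have "R0 #> (g \<otimes> a) = R0 #> g"
      using act[OF aA(1) g(1)] U(2)[OF aA(2)] g(2) a by simp
    then have "g \<otimes> a \<in> R0 #> g"
      using rcos_self[of "g \<otimes> a" R0] gG a R0(1) by simp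
    then obtain y where "y \<in> R0" "g \<otimes> a = y \<otimes> g"
      by (auto simp: r_coset_def)
    then show ?thesis
      using gG by (simp add: word_simps)
  qed
  have inj: "inj_on (\<lambda>a. g \<otimes> a \<otimes> inv g) R"
    using gG by (intro inj_onI) (simp add: word_simps)
  have conj_R: "(\<lambda>a. g \<otimes> a \<otimes> inv g) ` R = R0"
  proof (rule card_subset_eq)
    show "finite R0"
      using fin R0.subset finite_subset by blast
    show "(\<lambda>a. g \<otimes> a \<otimes> inv g) ` R \<subseteq> R0"
      using conj by blast
    show "card ((\<lambda>a. g \<otimes> a \<otimes> inv g) ` R) = card R0"
      using card_image[OF inj] R(3) R0(3) by simp
  qed
  have conj': "inv g \<otimes> y \<otimes> g \<in> R" if y: "y \<in> R0" for y
  proof -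
    obtain a where a: "a \<in> R" "y = g \<otimes> a \<otimes> inv g"
      using y conj_R by blast
    then show ?thesis
      using gG by (simp add: word_simps)
  qed
  define S where "S = {x \<in> carrier G. \<forall>y\<in>R. x \<otimes> y \<otimes> inv x \<in> R}"
  have finR: "finite R"
    using fin R.subset finite_subset by blast
  have Ssub: "subgroup S G"
    unfolding S_def using conj_stable_subgroup[OF R.subset finR] .
  have Msub: "subgroup M G" and M0sub: "subgroup M0 G"
    using M M0 by (auto simp: maximal_subgroup_def)
  have norm: "x \<otimes> y \<otimes> inv x \<in> W \<inter> A" if "subgroup W G" "x \<in> W" "y \<in> W \<inter> A" for W x y
    using that subgroup.m_closed[OF that(1)] subgroup.m_inv_closed[OF that(1)]
      subgroup.mem_carrier[OF that(1)] A.inv_op_closed2[of x y] by simp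
  have MS: "M \<subseteq> S"
    using norm[OF Msub] subgroup.mem_carrier[OF Msub] unfolding S_def R_def by blast
  \<comment> \<open>If \<open>R\<close> were normal in \<open>G\<close>, commutators of
    \<open>R\<close> with \<open>N\<close> would lie in \<open>M \<inter> N = L\<close>. Then
    \<open>R \<subseteq> C\<close>, and \<open>A = R <#> N \<subseteq> C\<close>, a contradiction.
    Maximality of \<open>M\<close> now makes it the full normalizer of \<open>R\<close>.\<close>
  have "S \<noteq> carrier G"
  proof
    assume SG: "S = carrier G"
    have "x \<in> C" if x: "x \<in> R" for x
    proof -
      have "x \<otimes> n \<otimes> inv x \<otimes> inv n \<in> L" if n: "n \<in> N" for n
      proof -
        have "n \<in> S"
          using n SG by simp
        then have "n \<otimes> inv x \<otimes> inv n \<in> R"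
          using x unfolding S_def by simp
        then have "x \<otimes> (n \<otimes> inv x \<otimes> inv n) \<in> R"
          using x by simp
        moreover have "x \<otimes> (n \<otimes> inv x \<otimes> inv n) = (x \<otimes> n \<otimes> inv x) \<otimes> inv n"
          using x n by (simp add: word_simps)
        moreover have "(x \<otimes> n \<otimes> inv x) \<otimes> inv n \<in> N"
          using N.inv_op_closed2[of x n] x n by simp
        ultimately have "x \<otimes> n \<otimes> inv x \<otimes> inv n \<in> M \<inter> N"
          unfolding R_def by simp
        then show ?thesis
          using maximal_supplement_Int[OF chief M(1-3)] by simp
      qed
      then show ?thesis
        using x unfolding C(1) centralizer_mod_def by simp
    qed
    then have "A \<subseteq> C"
      using set_mult_subset[OF C.subgroup_axioms _ NC, of R] R(2) by blast
    then show False
      using CA by blast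
  qed
  then have SM: "S = M"
    using M(1) Ssub MS unfolding maximal_subgroup_def by blast
  \<comment> \<open>\<open>M0\<close> normalizes \<open>R0\<close>, so its conjugate by
    \<open>g\<close> normalizes \<open>R\<close> and lies in \<open>S = M\<close>; both have order
    \<open>order G / q\<close>.\<close>
  have sub: "(\<lambda>x. inv g \<otimes> x \<otimes> g) ` M0 \<subseteq> M"
  proof
    fix z assume "z \<in> (\<lambda>x. inv g \<otimes> x \<otimes> g) ` M0"
    then obtain x where x: "x \<in> M0" "z = inv g \<otimes> x \<otimes> g" by blast
    have xG: "x \<in> carrier G"
      using x subgroup.mem_carrier[OF M0sub] by blast
    have "z \<otimes> y \<otimes> inv z \<in> R" if y: "y \<in> R" for y
    proof -
      have "x \<otimes> (g \<otimes> y \<otimes> inv g) \<otimes> inv x \<in> R0"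
        using norm[OF M0sub x(1)] conj[OF y] unfolding R0_def by blast
      then have "inv g \<otimes> (x \<otimes> (g \<otimes> y \<otimes> inv g) \<otimes> inv x) \<otimes> g \<in> R"
        by (rule conj')
      moreover have "inv g \<otimes> (x \<otimes> (g \<otimes> y \<otimes> inv g) \<otimes> inv x) \<otimes> g = z \<otimes> y \<otimes> inv z"
        using xG gG y x(2) by (simp add: word_simps)
      ultimately show ?thesis by simp
    qed
    then show "z \<in> M"
      using x xG gG SM[symmetric] by (simp add: S_def)
  qed
  have injM0: "inj_on (\<lambda>x. inv g \<otimes> x \<otimes> g) M0"
    using gG subgroup.mem_carrier[OF M0sub] by (intro inj_onI) (simp add: word_simps)
  have "(\<lambda>x. inv g \<otimes> x \<otimes> g) ` M0 = M"
  proof (rule card_subset_eq[OF _ sub])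
    show "finite M"
      using fin subgroup.subset[OF Msub] finite_subset by blast
    show "card ((\<lambda>x. inv g \<otimes> x \<otimes> g) ` M0) = card M"
      using card_image[OF injM0] oM oM0 qpos by simp
  qed
  then show thesis
    using that gG by blast
qed

text \<open>All members are conjugates of one member \<open>M0\<close>, and a conjugate depends only
  on the coset \<open>M0 #> g\<close>. There are \<open>|G : M0| = |N : L|\<close> cosets.\<close>

lemma card_maximal_supplements_fibre_le:
  assumes fin: "finite (carrier G)" and solv: "solvable G" and chief: "abelian_chief_factor G N L"
    and C: "C = centralizer_mod G N L" "C \<noteq> carrier G"
  shows "card {M. maximal_subgroup M G \<and> L \<subseteq> M \<and> \<not> N \<subseteq> M \<and> M \<inter> C = K} * card L \<le> card N"
    (is "card ?F * _ \<le> _")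
proof (cases "?F = {}")
  case False
  then obtain M0 where M0: "M0 \<in> ?F" by blast
  have N: "N \<lhd> G" and "L \<lhd> G"
    using chief by (auto simp: abelian_chief_factor_def)
  then have Nsub: "subgroup N G"
    using normal_imp_subgroup by blast
  have M0sub: "subgroup M0 G"
    using M0 by (simp add: maximal_subgroup_def)
  \<comment> \<open>\<open>f\<close> sends the coset \<open>M0 #> g\<close> to the conjugate of
    \<open>M0\<close> by \<open>g\<close>, without choosing a representative.\<close>
  define f where "f U = {inv u \<otimes> v | u v. u \<in> U \<and> v \<in> U}" for U
  have "?F \<subseteq> f ` (rcosets M0)"
  proof
    fix M assume M: "M \<in> ?F"
    obtain g where g: "g \<in> carrier G" "M = (\<lambda>x. inv g \<otimes> x \<otimes> g) ` M0"
      using maximal_supplements_conjugate[OF fin solv chief C, of M0 M] M0 M by auto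
    have "f (M0 #> g) = M"
    proof (intro equalityI subsetI)
      fix z assume "z \<in> f (M0 #> g)"
      then obtain x y where xy: "x \<in> M0" "y \<in> M0" "z = inv (x \<otimes> g) \<otimes> (y \<otimes> g)"
        by (auto simp: f_def r_coset_def)
      then have "z = inv g \<otimes> (inv x \<otimes> y) \<otimes> g"
        using g(1) subgroup.mem_carrier[OF M0sub] by (simp add: word_simps)
      moreover have "inv x \<otimes> y \<in> M0"
        using xy subgroup.m_closed[OF M0sub] subgroup.m_inv_closed[OF M0sub] by simp
      ultimately show "z \<in> M"
        using g(2) by blast
    next
      fix z assume "z \<in> M"
      then obtain x where x: "x \<in> M0" "z = inv g \<otimes> x \<otimes> g"
        using g(2) by blast
      then have "z = inv (\<one> \<otimes> g) \<otimes> (x \<otimes> g)"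
        using g(1) subgroup.mem_carrier[OF M0sub] by (simp add: word_simps)
      moreover have "\<one> \<otimes> g \<in> M0 #> g" "x \<otimes> g \<in> M0 #> g"
        using x(1) subgroup.one_closed[OF M0sub] unfolding r_coset_def by blast+
      ultimately show "z \<in> f (M0 #> g)"
        unfolding f_def by blast
    qed
    moreover have "M0 #> g \<in> rcosets M0"
      using g(1) by (auto simp: RCOSETS_def)
    ultimately show "M \<in> f ` (rcosets M0)"
      by blast
  qed
  moreover have "finite (rcosets M0)"
    using fin by (simp add: RCOSETS_def)
  ultimately have le: "card ?F \<le> card (rcosets M0)"
    using surj_card_le by blast
  have "M0 <#> N = carrier G"
    using maximal_set_mult_normal N M0 by blast
  moreover have "M0 \<inter> N = L"
    using maximal_supplement_Int[OF chief] M0 by blast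
  ultimately have "order G * card L = card M0 * card N"
    using card_set_mult[OF M0sub Nsub fin] by (simp add: order_def)
  then have "card (rcosets M0) * card M0 * card L = card M0 * card N"
    using lagrange[OF M0sub] by simp
  moreover have "card M0 > 0"
    using subgroup.finite_imp_card_positive[OF M0sub fin] .
  ultimately have "card (rcosets M0) * card L = card N"
    by (simp add: mult.assoc mult.left_commute)
  then show ?thesis
    using mult_le_mono1[OF le, of "card L"] by simp
next
  case True
  then show ?thesis
    by (simp only: card.empty mult_0 le0)
qed

end

section \<open>The bound on maximal overgroups\<close>

lemma maximal_subgroup_subset: "maximal_subgroup M G \<Longrightarrow> M \<subseteq> carrier G"
  by (simp add: maximal_subgroup_def subgroup.subset)

context group
begin

text \<open>Put \<open>q = |N : L|\<close> and \<open>u = |G : HN|\<close>. Once a supplement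
  exists, \<open>|G : H| = u * q\<close>, and \<open>(q - 1) * u\<close> supplements have to be
  allowed for. The bound is stated additively to avoid truncated subtraction.\<close>

lemma card_maximal_supplements_le:
  assumes fin: "finite (carrier G)" and solv: "solvable G" and chief: "abelian_chief_factor G N L"
    and H: "subgroup H G" "L \<subseteq> H" "\<not> N \<subseteq> H"
  shows "card {M. maximal_subgroup M G \<and> H \<subseteq> M \<and> \<not> N \<subseteq> M} + card (rcosets (H <#> N))
    \<le> card (rcosets H)"
proof -
  define Z where "Z = {M. maximal_subgroup M G \<and> H \<subseteq> M \<and> \<not> N \<subseteq> M}"
  interpret N: normal N G
    using chief by (simp add: abelian_chief_factor_def)
  interpret L: normal L G
    using chief by (simp add: abelian_chief_factor_def)
  interpret H: subgroup H G by fact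
  have LN: "L \<subset> N"
    using chief by (simp add: abelian_chief_factor_def)
  have HN: "subgroup (H <#> N) G"
    using set_mult_normal_subgroup H(1) N.normal_axioms by blast
  define u where "u = card (rcosets (H <#> N))"
  have lagH: "card (rcosets H) * card H = order G" and lagHN: "u * card (H <#> N) = order G"
    unfolding u_def using lagrange H(1) HN by blast+
  have Hpos: "card H > 0"
    using H.finite_imp_card_positive[OF fin] .
  have finHN: "finite (H <#> N)"
    using fin subgroup.subset[OF HN] finite_subset by blast
  have "card Z + u \<le> card (rcosets H)"
  proof (cases "Z = {}")
    case True
    have "card H \<le> card (H <#> N)"
      using card_mono[OF finHN] subset_set_mult(1)[OF H(1) N.subgroup_axioms] by blast
    then have "u * card H \<le> card (rcosets H) * card H"
      unfolding lagH lagHN[symmetric] by (rule mult_le_mono2)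
    then show ?thesis
      using True Hpos by simp
  next
    case False
    then obtain M1 where M1: "M1 \<in> Z" by blast
    have ZD: "maximal_subgroup M G" "H \<subseteq> M" "L \<subseteq> M" "\<not> N \<subseteq> M" "subgroup M G" "M \<inter> N = L"
      if "M \<in> Z" for M
      using that H(2) maximal_supplement_Int[OF chief, of M]
      by (auto simp: Z_def maximal_subgroup_def)
    have Lpos: "card L > 0"
      using L.finite_imp_card_positive fin by blast
    obtain q where q: "card N = q * card L"
      using card_cosets_in_subgroup[OF L.subgroup_axioms N.subgroup_axioms] LN
      by (metis psubset_imp_subset)
    have "card L < card N"
      using LN fin N.subset finite_subset psubset_card_mono by metis
    then have q2: "q \<ge> 2"
      using q by (cases "q = 0 \<or> q = 1") auto
    have "H \<inter> N = L"
      using ZD[OF M1] H(2) LN by blast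
    then have "card (H <#> N) * card L = card H * card N"
      using card_set_mult[OF H(1) N.subgroup_axioms fin] by simp
    then have cHN: "card (H <#> N) = card H * q"
      using q Lpos by simp
    then have "card (rcosets H) * card H = u * q * card H"
      using lagH lagHN by (simp add: ac_simps)
    then have i: "card (rcosets H) = u * q"
      using Hpos by simp
    define C where "C = centralizer_mod G N L"
    have Cn: "C \<lhd> G"
      unfolding C_def using centralizer_mod_normal N.normal_axioms L.normal_axioms by blast
    interpret C: normal C G by fact
    have NC: "N \<subseteq> C"
      using chief by (simp add: C_def abelian_chief_factor_def)
    define D where "D = H \<inter> C"
    have Dsub: "subgroup D G"
      unfolding D_def using H(1) C.subgroup_axioms subgroups_Inter_pair by blast
    have Dpos: "card D > 0"
      using subgroup.finite_imp_card_positive[OF Dsub fin] .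
    define KK where "KK = {K. K \<lhd> G \<and> K <#> N = C \<and> K \<inter> N = L \<and> D \<subseteq> K}"
    have "card KK * card D * card N \<le> card C * card L"
      unfolding KK_def
    proof (rule card_normal_complements_le[OF fin N.normal_axioms L.normal_axioms LN _ Dsub])
      show "Y = L \<or> Y = N" if "Y \<lhd> G" "L \<subseteq> Y" "Y \<subseteq> N" for Y
        using that chief unfolding abelian_chief_factor_def by blast
      show "L \<subseteq> D"
        using H(2) LN NC by (auto simp: D_def)
    qed
    then have KK_le: "card KK * card D * q \<le> card C"
      using q Lpos by (simp add: mult.assoc[symmetric])
    have HC: "subgroup (H <#> C) G"
      using set_mult_normal_subgroup H(1) Cn by blast
    define t where "t = card (rcosets (H <#> C))"
    have lagHC: "t * card (H <#> C) = order G"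
      unfolding t_def using lagrange HC by blast
    have "card (H <#> C) * card D = card H * card C"
      unfolding D_def using card_set_mult[OF H(1) C.subgroup_axioms fin] .
    then have "t * (card H * card C) = order G * card D"
      using lagHC by (metis mult.assoc)
    also have "order G = u * (card H * q)"
      using lagHN cHN by simp
    finally have "card H * (t * card C) = card H * (u * q * card D)"
      by (simp add: ac_simps)
    then have tC: "t * card C = u * q * card D"
      using Hpos by simp
    have "t * (card KK * card D * q) \<le> t * card C"
      using KK_le by simp
    then have "(t * card KK) * (card D * q) \<le> u * (card D * q)"
      unfolding tC by (simp add: ac_simps)
    \<comment> \<open>With \<open>t = |G : HC|\<close>, the complement bound becomes
      \<open>t * card KK \<le> u\<close>: the orders of \<open>H <#> C\<close> and
      \<open>H <#> N\<close> turn \<open>|C : D| / q\<close> into \<open>u / t\<close>.\<close>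
    then have tE: "t * card KK \<le> u"
      using Dpos q2 by simp
    have inKK: "M \<inter> C \<in> KK" if M: "M \<in> Z" for M
    proof -
      have "M \<inter> C \<lhd> G"
        using maximal_supplement_Int_normal[OF chief ZD(1,3,4)[OF M] Cn NC] by (simp add: C_def)
      moreover have "(M \<inter> C) <#> N = C"
        using dedekind_modular[OF ZD(5)[OF M] N.subgroup_axioms C.subgroup_axioms NC]
          maximal_set_mult_normal[OF ZD(1)[OF M] N.normal_axioms ZD(4)[OF M]] C.subset by simp
      moreover have "M \<inter> C \<inter> N = L"
        using ZD(6)[OF M] NC by blast
      moreover have "D \<subseteq> M \<inter> C"
        using ZD(2)[OF M] by (auto simp: D_def)
      ultimately show ?thesis
        by (simp add: KK_def)
    qed
    have finKK: "finite KK"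
    proof (rule finite_subset)
      show "KK \<subseteq> Pow (carrier G)"
        unfolding KK_def using normal_imp_subgroup subgroup.subset by blast
      show "finite (Pow (carrier G))"
        using fin by simp
    qed
    have "card Z + u \<le> u * q"
    proof (cases "H <#> C = carrier G")
      case True
      \<comment> \<open>So \<open>M\<close> is recovered from \<open>M \<inter> C\<close> and
        \<open>card Z \<le> card KK \<le> u\<close>, which is at most \<open>(q - 1) * u\<close>
        because \<open>q \<ge> 2\<close>.\<close>
      have rec: "M = H <#> (M \<inter> C)" if M: "M \<in> Z" for M
      proof
        show "H <#> (M \<inter> C) \<subseteq> M"
          using set_mult_subset[OF ZD(5)[OF M] ZD(2)[OF M]] by blast
        show "M \<subseteq> H <#> (M \<inter> C)"
        proof
          fix m assume m: "m \<in> M"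
          then have "m \<in> H <#> C"
            using True subgroup.mem_carrier[OF ZD(5)[OF M]] by simp
          then obtain h c where hc: "h \<in> H" "c \<in> C" "m = h \<otimes> c"
            by (auto simp: set_mult_def)
          have "c = inv h \<otimes> m"
            using hc by (simp add: word_simps)
          moreover have "inv h \<in> M"
            using hc(1) ZD(2)[OF M] H.m_inv_closed by blast
          ultimately have "c \<in> M"
            using m subgroup.m_closed[OF ZD(5)[OF M]] by blast
          then show "m \<in> H <#> (M \<inter> C)"
            using hc unfolding set_mult_def by blast
        qed
      qed
      have "inj_on (\<lambda>M. M \<inter> C) Z"
        using rec by (intro inj_onI) metis
      moreover have "(\<lambda>M. M \<inter> C) ` Z \<subseteq> KK"
        using inKK by blast
      ultimately have "card Z \<le> card KK"
        using card_inj_on_le finKK by blast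
      moreover have "t \<noteq> 0"
        using lagHC fin order_gt_0_iff_finite by (cases "t = 0") auto
      then have "card KK \<le> t * card KK" by simp
      ultimately have "card Z + u \<le> u * 2"
        using tE by linarith
      also have "\<dots> \<le> u * q"
        using q2 by (rule mult_le_mono2)
      finally show ?thesis .
    next
      case False
      have CG: "C \<noteq> carrier G"
      proof
        assume "C = carrier G"
        then have "carrier G \<subseteq> H <#> C"
          using subset_set_mult(2)[OF H(1) C.subgroup_axioms] by simp
        then show False
          using False subgroup.subset[OF HC] by blast
      qed
      \<comment> \<open>Fibres may now have up to \<open>q\<close> members, but
        \<open>t \<ge> 2\<close> halves the number of possible intersections:
        \<open>card Z \<le> q * card KK \<le> q * u / 2 \<le> (q - 1) * u\<close>.\<close>
      have fib: "card {M \<in> Z. M \<inter> C = K} \<le> q" for K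
      proof -
        let ?F = "{M. maximal_subgroup M G \<and> L \<subseteq> M \<and> \<not> N \<subseteq> M \<and> M \<inter> C = K}"
        have "finite ?F"
        proof (rule finite_subset)
          show "?F \<subseteq> Pow (carrier G)"
            using maximal_subgroup_subset by blast
          show "finite (Pow (carrier G))"
            using fin by simp
        qed
        moreover have "{M \<in> Z. M \<inter> C = K} \<subseteq> ?F"
          using ZD by blast
        ultimately have "card {M \<in> Z. M \<inter> C = K} \<le> card ?F"
          by (rule card_mono)
        moreover have "card ?F * card L \<le> q * card L"
          using card_maximal_supplements_fibre_le[OF fin solv chief C_def CG, of K] q by simp
        then have "card ?F \<le> q"
          using Lpos by simp
        ultimately show ?thesis
          by (rule le_trans)
      qed
      have "Z = (\<Union>K\<in>KK. {M \<in> Z. M \<inter> C = K})"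
        using inKK by blast
      then have "card Z \<le> (\<Sum>K\<in>KK. card {M \<in> Z. M \<inter> C = K})"
        using card_UN_le[OF finKK, of "\<lambda>K. {M \<in> Z. M \<inter> C = K}"] by simp
      also have "\<dots> \<le> (\<Sum>K\<in>KK. q)"
        using fib by (intro sum_mono) blast
      finally have cZ: "card Z \<le> card KK * q" by simp
      have "t \<noteq> 0"
        using lagHC fin order_gt_0_iff_finite by (cases "t = 0") auto
      moreover have "t \<noteq> 1"
      proof
        assume "t = 1"
        then have "card (H <#> C) = card (carrier G)"
          using lagHC by (simp add: order_def)
        then show False
          using False card_subset_eq[OF fin subgroup.subset[OF HC]] by blast
      qed
      ultimately have "2 * card KK \<le> t * card KK"
        by (intro mult_le_mono1) simp
      then have "2 * card KK \<le> u"
        using tE by linarith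
      then have "2 * card KK * q \<le> u * q"
        by (rule mult_le_mono1)
      moreover have "u * 2 \<le> u * q"
        using q2 by (rule mult_le_mono2)
      ultimately show ?thesis
        using cZ by linarith
    qed
    then show ?thesis
      using i by simp
  qed
  then show ?thesis
    by (simp add: Z_def u_def)
qed

text \<open>The maximal overgroups of \<open>H\<close> split into those that supplement
  \<open>N\<close> and those that contain \<open>H <#> N\<close>. The first are bounded directly,
  the second by induction, as \<open>H <#> N\<close> is strictly larger than \<open>H\<close>; the
  two bounds telescope.\<close>

theorem solvable_max_count_le:
  assumes fin: "finite (carrier G)" and solv: "solvable G"
    and H: "subgroup H G" "H \<noteq> carrier G"
  shows "max_count H G \<le> card (rcosets H) - 1"
  using H
proof (induction "order G - card H" arbitrary: H rule: less_induct)
  case less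
  note H = less.prems
  obtain N L where chief: "abelian_chief_factor G N L" and LH: "L \<subseteq> H" and NH: "\<not> N \<subseteq> H"
    using solvable_abelian_chief_factor_outside_subgroup[OF fin solv H] by blast
  have Nn: "N \<lhd> G"
    using chief by (simp add: abelian_chief_factor_def)
  then have Nsub: "subgroup N G"
    using normal_imp_subgroup by blast
  have HN: "subgroup (H <#> N) G"
    using set_mult_normal_subgroup H(1) Nn by blast
  note inc = subset_set_mult[OF H(1) Nsub]
  have HNG: "H <#> N \<subseteq> carrier G"
    using subgroup.subset[OF HN] .
  define Z where "Z = {M. maximal_subgroup M G \<and> H \<subseteq> M \<and> \<not> N \<subseteq> M}"
  define W where "W = {M. maximal_subgroup M G \<and> H <#> N \<subseteq> M}"
  have split: "{M. maximal_subgroup M G \<and> H \<subseteq> M} = Z \<union> W"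
  proof (intro equalityI subsetI)
    fix M assume M: "M \<in> {M. maximal_subgroup M G \<and> H \<subseteq> M}"
    then have "subgroup M G"
      by (simp add: maximal_subgroup_def)
    then have "N \<subseteq> M \<Longrightarrow> H <#> N \<subseteq> M"
      using set_mult_subset[of M H N] M by simp
    then show "M \<in> Z \<union> W"
      using M by (auto simp: Z_def W_def)
  next
    fix M assume "M \<in> Z \<union> W"
    then show "M \<in> {M. maximal_subgroup M G \<and> H \<subseteq> M}"
      using inc(1) by (auto simp: Z_def W_def)
  qed
  \<comment> \<open>Positivity of this index makes the truncated \<open>- 1\<close> in the bound for
    \<open>W\<close> a true subtraction.\<close>
  have upos: "card (rcosets (H <#> N)) > 0"
    using lagrange[OF HN] fin order_gt_0_iff_finite by (cases "card (rcosets (H <#> N)) = 0") auto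
  have Wle: "card W \<le> card (rcosets (H <#> N)) - 1"
  proof (cases "H <#> N = carrier G")
    \<comment> \<open>The induction hypothesis covers only proper subgroups; here no maximal
      subgroup contains \<open>H <#> N\<close>.\<close>
    case True
    have "W = {}"
    proof -
      have False if "M \<in> W" for M
        using that True maximal_subgroup_subset[of M G] by (auto simp: W_def maximal_subgroup_def)
      then show ?thesis by blast
    qed
    then show ?thesis by simp
  next
    case False
    have "H \<subset> H <#> N"
      using inc NH by blast
    then have "card H < card (H <#> N)"
      using HNG fin finite_subset psubset_card_mono by metis
    moreover have "card (H <#> N) \<le> order G"
      unfolding order_def using HNG fin card_mono by blast
    ultimately have "order G - card (H <#> N) < order G - card H"
      by linarith
    then show ?thesis
      using less.hyps[OF _ HN False] by (simp add: max_count_def W_def)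
  qed
  have "max_count H G \<le> card Z + card W"
    unfolding max_count_def split by (rule card_Un_le)
  moreover have "card Z + card (rcosets (H <#> N)) \<le> card (rcosets H)"
    unfolding Z_def using card_maximal_supplements_le[OF fin solv chief H(1) LH NH] .
  ultimately show ?case
    using Wle upos by linarith
qed

end

section \<open>Systems of imprimitivity\<close>

locale transitive_perm_group =
  fixes \<Omega> :: "'a set" and P :: "('a \<Rightarrow> 'a) set" and x :: 'a
  assumes P: "subgroup P (BijGroup \<Omega>)" and trans: "perm_transitive \<Omega> P" and x: "x \<in> \<Omega>"
begin

abbreviation "\<G> \<equiv> (BijGroup \<Omega>)\<lparr>carrier := P\<rparr>"

sublocale group \<G>
  using group.subgroup_imp_group[OF group_BijGroup P] .

sublocale act: transitive_action \<G> \<Omega> "\<lambda>g. g"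
proof -
  have "(\<lambda>g. g) \<in> hom \<G> (BijGroup \<Omega>)"
    using subgroup.subset[OF P] by (auto simp: hom_def)
  then show "transitive_action \<G> \<Omega> (\<lambda>g. g)"
    using trans group_axioms group_BijGroup[of \<Omega>]
    by (auto simp: transitive_action_def transitive_action_axioms_def group_action_def group_hom_def
        group_hom_axioms_def perm_transitive_def)
qed

lemma mult_apply: "g \<in> P \<Longrightarrow> h \<in> P \<Longrightarrow> z \<in> \<Omega> \<Longrightarrow> (g \<otimes>\<^bsub>\<G>\<^esub> h) z = g (h z)"
  using act.composition_rule[of z g h] by simp

lemma mult_in: "g \<in> P \<Longrightarrow> h \<in> P \<Longrightarrow> g \<otimes>\<^bsub>\<G>\<^esub> h \<in> P"
  using m_closed[of g h] by simp

lemma inv_in: "g \<in> P \<Longrightarrow> inv\<^bsub>\<G>\<^esub> g \<in> P"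
  using inv_closed[of g] by simp

lemma one_in: "\<one>\<^bsub>\<G>\<^esub> \<in> P"
  using one_closed by simp

lemma one_apply: "z \<in> \<Omega> \<Longrightarrow> \<one>\<^bsub>\<G>\<^esub> z = z"
  using act.id_eq_one by (metis restrict_apply')

lemma inv_apply: "g \<in> P \<Longrightarrow> z \<in> \<Omega> \<Longrightarrow> (inv\<^bsub>\<G>\<^esub> g) (g z) = z"
  using act.orbit_sym_aux[of g z] by simp

lemma apply_in: "g \<in> P \<Longrightarrow> z \<in> \<Omega> \<Longrightarrow> g z \<in> \<Omega>"
  using act.element_image[of g z] by simp

lemma reach: "y \<in> \<Omega> \<Longrightarrow> z \<in> \<Omega> \<Longrightarrow> \<exists>g\<in>P. g y = z"
  using trans by (auto simp: perm_transitive_def)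

definition point_stab :: "('a \<Rightarrow> 'a) set" where
  "point_stab = {g \<in> P. g x = x}"

text \<open>For an invariant partition this is the setwise stabilizer of the block \<open>B\<close>
  through \<open>x\<close>: \<open>g\<close> \<open>B\<close> and \<open>B\<close> are blocks that
  share the point \<open>g x\<close>.\<close>

definition block_stab :: "'a set set \<Rightarrow> ('a \<Rightarrow> 'a) set" where
  "block_stab \<P> = {g \<in> P. \<exists>B\<in>\<P>. x \<in> B \<and> g x \<in> B}"

lemma point_stab_subgroup: "subgroup point_stab \<G>"
  using act.stabilizer_subgroup[OF x] by (simp add: stabilizer_def point_stab_def)

lemma card_rcosets_point_stab:
  assumes "finite P"
  shows "card (rcosets\<^bsub>\<G>\<^esub> point_stab) = card \<Omega>"
proof -
  have "orbit \<G> (\<lambda>g. g) x = \<Omega>"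
    using apply_in x reach[OF x] by (auto simp: orbit_def)
  then have "card \<Omega> * card point_stab = order \<G>"
    using act.orbit_stabilizer_theorem[OF x] by (simp add: stabilizer_def point_stab_def)
  then have "card (rcosets\<^bsub>\<G>\<^esub> point_stab) * card point_stab = card \<Omega> * card point_stab"
    using lagrange[OF point_stab_subgroup] by simp
  moreover have "card point_stab > 0"
    using subgroup.finite_imp_card_positive[OF point_stab_subgroup] assms by simp
  ultimately show ?thesis by simp
qed

lemma finite_group: "finite \<Omega> \<Longrightarrow> finite P"
proof -
  assume "finite \<Omega>"
  moreover have "P \<subseteq> \<Omega> \<rightarrow>\<^sub>E \<Omega>"
    using subgroup.subset[OF P] apply_in by (auto simp: BijGroup_def Bij_def PiE_def)
  ultimately show "finite P"
    using finite_PiE finite_subset by metis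
qed

section \<open>Blocks and block stabilizers of an invariant partition\<close>

context
  fixes \<P> :: "'a set set"
  assumes inv_part: "invariant_partition \<Omega> P \<P>"
begin

lemma block_eq: "B \<in> \<P> \<Longrightarrow> C \<in> \<P> \<Longrightarrow> z \<in> B \<Longrightarrow> z \<in> C \<Longrightarrow> B = C"
  using inv_part by (auto simp: invariant_partition_def partition_on_def disjoint_def)

lemma block_image: "B \<in> \<P> \<Longrightarrow> g \<in> P \<Longrightarrow> g ` B \<in> \<P>"
  using inv_part by (auto simp: invariant_partition_def)

lemma block_subset: "B \<in> \<P> \<Longrightarrow> B \<subseteq> \<Omega>"
  using inv_part by (auto simp: invariant_partition_def partition_on_def)

lemma block_nonempty: "B \<in> \<P> \<Longrightarrow> B \<noteq> {}"
  using inv_part by (auto simp: invariant_partition_def partition_on_def)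

lemma ex_block: "z \<in> \<Omega> \<Longrightarrow> \<exists>B\<in>\<P>. z \<in> B"
  using inv_part by (auto simp: invariant_partition_def partition_on_def)

lemma block_stab_iff:
  assumes "B \<in> \<P>" "x \<in> B"
  shows "g \<in> block_stab \<P> \<longleftrightarrow> g \<in> P \<and> g x \<in> B"
  using assms block_eq by (auto simp: block_stab_def)

lemma block_stab_image:
  assumes B: "B \<in> \<P>" "x \<in> B" and g: "g \<in> block_stab \<P>"
  shows "g ` B = B"
  using block_eq[of "g ` B" B "g x"] block_image B g block_stab_iff[OF B] by blast

text \<open>By transitivity each point of \<open>B\<close> is \<open>g x\<close> for some
  \<open>g\<close>, and such a \<open>g\<close> lies in the block stabilizer. Thus the stabilizer
  determines the block through \<open>x\<close>, whose translates form the partition; this is the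
  source of injectivity.\<close>

lemma block_eq_orbit:
  assumes B: "B \<in> \<P>" "x \<in> B"
  shows "B = (\<lambda>g. g x) ` block_stab \<P>"
proof
  show "(\<lambda>g. g x) ` block_stab \<P> \<subseteq> B"
    using block_stab_iff[OF B] by blast
  show "B \<subseteq> (\<lambda>g. g x) ` block_stab \<P>"
  proof
    fix z assume z: "z \<in> B"
    then obtain g where "g \<in> P" "g x = z"
      using reach[OF x] block_subset[OF B(1)] by blast
    then show "z \<in> (\<lambda>g. g x) ` block_stab \<P>"
      using z block_stab_iff[OF B] by blast
  qed
qed

lemma partition_eq_translates:
  assumes B: "B \<in> \<P>" "x \<in> B"
  shows "\<P> = (\<lambda>g. g ` B) ` P"
proof
  show "(\<lambda>g. g ` B) ` P \<subseteq> \<P>"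
    using block_image B by blast
  show "\<P> \<subseteq> (\<lambda>g. g ` B) ` P"
  proof
    fix C assume C: "C \<in> \<P>"
    then obtain z where z: "z \<in> C"
      using block_nonempty by blast
    then obtain g where g: "g \<in> P" "g x = z"
      using reach[OF x] block_subset[OF C] by blast
    then have "g ` B = C"
      using block_eq[of "g ` B" C z] block_image B C z by blast
    then show "C \<in> (\<lambda>g. g ` B) ` P"
      using g by blast
  qed
qed

lemma block_stab_subgroup: "subgroup (block_stab \<P>) \<G>"
proof -
  obtain B where B: "B \<in> \<P>" "x \<in> B"
    using ex_block x by blast
  note iff = block_stab_iff[OF B]
  show ?thesis
  proof (rule subgroupI)
    show "block_stab \<P> \<subseteq> carrier \<G>"
      by (auto simp: block_stab_def)
    have "\<one>\<^bsub>\<G>\<^esub> \<in> block_stab \<P>"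
      using iff one_in one_apply[OF x] B by metis
    then show "block_stab \<P> \<noteq> {}" by blast
  next
    fix g assume g: "g \<in> block_stab \<P>"
    then have gP: "g \<in> P"
      using iff by blast
    obtain b where b: "b \<in> B" "x = g b"
      using block_stab_image[OF B g] B(2) by blast
    have "(inv\<^bsub>\<G>\<^esub> g) x = b"
      using inv_apply[OF gP] b block_subset[OF B(1)] by blast
    then show "inv\<^bsub>\<G>\<^esub> g \<in> block_stab \<P>"
      using iff inv_in[OF gP] b by metis
  next
    fix g h assume g: "g \<in> block_stab \<P>" and h: "h \<in> block_stab \<P>"
    then have gh: "g \<in> P" "h \<in> P" "h x \<in> B"
      using iff by blast+
    then have "g (h x) \<in> B"
      using block_stab_image[OF B g] by blast
    then show "g \<otimes>\<^bsub>\<G>\<^esub> h \<in> block_stab \<P>"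
      using iff mult_in[OF gh(1,2)] mult_apply[OF gh(1,2) x] by metis
  qed
qed

lemma point_stab_subset_block_stab: "point_stab \<subseteq> block_stab \<P>"
proof -
  obtain B where B: "B \<in> \<P>" "x \<in> B"
    using ex_block x by blast
  have "g \<in> block_stab \<P>" if "g \<in> point_stab" for g
    using that B(2) unfolding block_stab_iff[OF B] by (simp add: point_stab_def)
  then show ?thesis by blast
qed

end

lemma block_stab_inj: "inj_on block_stab {\<P>. invariant_partition \<Omega> P \<P>}"
proof (rule inj_onI, clarsimp)
  fix \<P> Q assume PQ: "invariant_partition \<Omega> P \<P>" "invariant_partition \<Omega> P Q"
    and eq: "block_stab \<P> = block_stab Q"
  obtain B where B: "B \<in> \<P>" "x \<in> B"
    using ex_block[OF PQ(1) x] by blast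
  obtain C where C: "C \<in> Q" "x \<in> C"
    using ex_block[OF PQ(2) x] by blast
  have "B = C"
    using block_eq_orbit[OF PQ(1) B] block_eq_orbit[OF PQ(2) C] eq by simp
  then show "\<P> = Q"
    using partition_eq_translates[OF PQ(1) B] partition_eq_translates[OF PQ(2) C] by simp
qed

text \<open>\<open>inv k \<otimes> h\<close> fixes \<open>x\<close>, hence lies in \<open>K\<close>.
  So membership in an overgroup of the point stabilizer depends only on the image of
  \<open>x\<close>.\<close>

lemma overgroup_memI:
  assumes K: "subgroup K \<G>" "point_stab \<subseteq> K" and h: "h \<in> P" and k: "k \<in> K" and eq: "h x = k x"
  shows "h \<in> K"
proof -
  have kP: "k \<in> P"
    using k subgroup.subset[OF K(1)] by auto
  have "(inv\<^bsub>\<G>\<^esub> k \<otimes>\<^bsub>\<G>\<^esub> h) x = x"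
    using mult_apply[OF inv_in[OF kP] h x] inv_apply[OF kP x] eq by simp
  then have "inv\<^bsub>\<G>\<^esub> k \<otimes>\<^bsub>\<G>\<^esub> h \<in> K"
    using K(2) mult_in[OF inv_in[OF kP] h] by (auto simp: point_stab_def)
  then have "k \<otimes>\<^bsub>\<G>\<^esub> (inv\<^bsub>\<G>\<^esub> k \<otimes>\<^bsub>\<G>\<^esub> h) \<in> K"
    using subgroup.m_closed[OF K(1) k] by blast
  then show ?thesis
    using mult_inv_cancel[of k h] kP h by simp
qed

text \<open>The orbit \<open>B\<close> of \<open>x\<close> under \<open>K\<close> is a block because
  \<open>K\<close> contains the point stabilizer: if the translates by \<open>g\<close> and
  \<open>h\<close> meet, then \<open>inv h \<otimes> g\<close> lies in \<open>K\<close> and the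
  translates coincide.\<close>

lemma invariant_partition_of_overgroup:
  assumes K: "subgroup K \<G>" "point_stab \<subseteq> K"
  defines "B \<equiv> (\<lambda>g. g x) ` K"
  shows "invariant_partition \<Omega> P ((\<lambda>g. g ` B) ` P)"
proof -
  have KP: "K \<subseteq> P"
    using subgroup.subset[OF K(1)] by simp
  have BO: "B \<subseteq> \<Omega>"
    using KP apply_in x by (auto simp: B_def)
  have oneK: "\<one>\<^bsub>\<G>\<^esub> \<in> K"
    using subgroup.one_closed[OF K(1)] .
  have xB: "x \<in> B"
    unfolding B_def using oneK one_apply[OF x] by (metis image_eqI)
  note memK = overgroup_memI[OF K]
  have KB: "k ` B \<subseteq> B" if k: "k \<in> K" for k
  proof
    fix z assume "z \<in> k ` B"
    then obtain h where h: "h \<in> K" "z = k (h x)"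
      by (auto simp: B_def)
    then have "z = (k \<otimes>\<^bsub>\<G>\<^esub> h) x"
      using mult_apply[of k h x] k KP x by (simp add: subset_iff)
    then show "z \<in> B"
      using subgroup.m_closed[OF K(1) k h(1)] unfolding B_def by blast
  qed
  have comp: "(g \<otimes>\<^bsub>\<G>\<^esub> h) ` B = g ` h ` B" if "g \<in> P" "h \<in> P" for g h
  proof -
    have "(g \<otimes>\<^bsub>\<G>\<^esub> h) z = g (h z)" if "z \<in> B" for z
      using mult_apply[OF \<open>g \<in> P\<close> \<open>h \<in> P\<close>] that BO by blast
    then show ?thesis
      by (auto simp: image_image)
  qed
  have sub: "g ` B \<subseteq> h ` B" if gh: "g \<in> P" "h \<in> P" and z: "z \<in> g ` B" "z \<in> h ` B" for g h z
  proof -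
    obtain a where a: "a \<in> K" "z = g (a x)"
      using z(1) by (auto simp: B_def)
    obtain b where b: "b \<in> K" "z = h (b x)"
      using z(2) by (auto simp: B_def)
    have ab: "a \<in> P" "b \<in> P"
      using a b KP by blast+
    let ?f = "inv\<^bsub>\<G>\<^esub> h \<otimes>\<^bsub>\<G>\<^esub> g"
    have fP: "?f \<in> P"
      using mult_in inv_in gh by blast
    have "(?f \<otimes>\<^bsub>\<G>\<^esub> a) x = ?f (a x)"
      using mult_apply[OF fP ab(1) x] .
    also have "\<dots> = (inv\<^bsub>\<G>\<^esub> h) (g (a x))"
      using mult_apply[OF inv_in[OF gh(2)] gh(1)] apply_in[OF ab(1) x] .
    also have "\<dots> = b x"
      using a(2) b(2) inv_apply[OF gh(2) apply_in[OF ab(2) x]] by simp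
    finally have "?f \<otimes>\<^bsub>\<G>\<^esub> a \<in> K"
      using memK[OF mult_in[OF fP ab(1)] b(1)] by blast
    then have "(?f \<otimes>\<^bsub>\<G>\<^esub> a) \<otimes>\<^bsub>\<G>\<^esub> inv\<^bsub>\<G>\<^esub> a \<in> K"
      using subgroup.m_closed[OF K(1)] subgroup.m_inv_closed[OF K(1) a(1)] by blast
    moreover have "(?f \<otimes>\<^bsub>\<G>\<^esub> a) \<otimes>\<^bsub>\<G>\<^esub> inv\<^bsub>\<G>\<^esub> a = ?f"
      using inv_solve_right[of ?f "?f \<otimes>\<^bsub>\<G>\<^esub> a" a] fP ab mult_in[OF fP ab(1)] by simp
    ultimately have fK: "?f \<in> K"
      by simp
    have "g = h \<otimes>\<^bsub>\<G>\<^esub> ?f"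
      using mult_inv_cancel[of h g] gh by simp
    then have "g ` B = h ` ?f ` B"
      using comp[OF gh(2) fP] by simp
    then show ?thesis
      using KB[OF fK] by blast
  qed
  have "partition_on \<Omega> ((\<lambda>g. g ` B) ` P)"
  proof (rule partition_onI)
    show "\<Union> ((\<lambda>g. g ` B) ` P) = \<Omega>"
    proof
      show "\<Union> ((\<lambda>g. g ` B) ` P) \<subseteq> \<Omega>"
        using BO apply_in by blast
      show "\<Omega> \<subseteq> \<Union> ((\<lambda>g. g ` B) ` P)"
        using reach[OF x] xB by blast
    qed
    show "{} \<notin> (\<lambda>g. g ` B) ` P"
      using xB by blast
    show "disjnt p p'" if p: "p \<in> (\<lambda>g. g ` B) ` P" "p' \<in> (\<lambda>g. g ` B) ` P" "p \<noteq> p'" for p p'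
    proof (rule ccontr)
      assume "\<not> disjnt p p'"
      then obtain z where "z \<in> p" "z \<in> p'"
        by (auto simp: disjnt_def)
      then show False
        using p sub by blast
    qed
  qed
  moreover have "g ` C \<in> (\<lambda>g. g ` B) ` P" if g: "g \<in> P" and C: "C \<in> (\<lambda>g. g ` B) ` P" for g C
  proof -
    obtain h where h: "h \<in> P" "C = h ` B"
      using C by blast
    then have "g ` C = (g \<otimes>\<^bsub>\<G>\<^esub> h) ` B"
      using comp[OF g h(1)] by blast
    then show ?thesis
      using mult_in[OF g h(1)] by blast
  qed
  ultimately show ?thesis
    unfolding invariant_partition_def by blast
qed

text \<open>An overgroup \<open>K\<close> of the block stabilizer gives a partition \<open>Q\<close>
  refined by the given one. By maximality \<open>Q\<close> is either the one-block partition, and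
  then \<open>K = P\<close>, or the given one, and then \<open>K\<close> is the block
  stabilizer.\<close>

lemma block_stab_maximal:
  assumes max: "maximal_system_of_imprimitivity \<Omega> P \<P>"
  shows "maximal_subgroup (block_stab \<P>) \<G>"
proof -
  have ip: "invariant_partition \<Omega> P \<P>" and nontriv: "\<P> \<noteq> {\<Omega>}"
    and coarsest: "\<And>Q. invariant_partition \<Omega> P Q \<Longrightarrow> Q \<noteq> {\<Omega>} \<Longrightarrow> refines \<P> Q \<Longrightarrow> Q = \<P>"
    using max by (auto simp: maximal_system_of_imprimitivity_def system_of_imprimitivity_def)
  obtain B where B: "B \<in> \<P>" "x \<in> B"
    using ex_block[OF ip x] by blast
  note iff = block_stab_iff[OF ip B]
  have neq: "block_stab \<P> \<noteq> P"
  proof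
    assume "block_stab \<P> = P"
    then have "B = \<Omega>"
      using block_eq_orbit[OF ip B] reach[OF x] block_subset[OF ip B(1)] by blast
    have "C = B" if C: "C \<in> \<P>" for C
    proof -
      obtain z where "z \<in> C"
        using block_nonempty[OF ip C] by blast
      then show ?thesis
        using block_eq[OF ip C B(1)] block_subset[OF ip C] \<open>B = \<Omega>\<close> by blast
    qed
    then have "\<P> = {\<Omega>}"
      using B(1) \<open>B = \<Omega>\<close> by blast
    then show False
      using nontriv by blast
  qed
  have "K = block_stab \<P> \<or> K = P" if K: "subgroup K \<G>" "block_stab \<P> \<subseteq> K" for K
  proof -
    have stab: "point_stab \<subseteq> K"
      using point_stab_subset_block_stab[OF ip] K(2) by blast
    have KP: "K \<subseteq> P"
      using subgroup.subset[OF K(1)] by simp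
    define D where "D = (\<lambda>g. g x) ` K"
    define Q where "Q = (\<lambda>g. g ` D) ` P"
    have Q: "invariant_partition \<Omega> P Q"
      unfolding Q_def D_def by (rule invariant_partition_of_overgroup[OF K(1) stab])
    have BD: "B \<subseteq> D"
      unfolding D_def using block_eq_orbit[OF ip B] K(2) by blast
    have DO: "D \<subseteq> \<Omega>"
      using KP apply_in x by (auto simp: D_def)
    have DQ: "D \<in> Q"
    proof -
      have "\<one>\<^bsub>\<G>\<^esub> ` D = D"
        using DO one_apply by force
      then show ?thesis
        unfolding Q_def using one_in by (metis image_eqI)
    qed
    have "refines \<P> Q"
      unfolding refines_def
    proof
      fix C assume "C \<in> \<P>"
      then obtain g where "g \<in> P" "C = g ` B"
        using partition_eq_translates[OF ip B] by blast
      then show "\<exists>E\<in>Q. C \<subseteq> E"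
        using BD unfolding Q_def by blast
    qed
    then consider "Q = {\<Omega>}" | "Q = \<P>"
      using coarsest Q by blast
    then show ?thesis
    proof cases
      case 1
      then have DOm: "D = \<Omega>"
        using DQ by blast
      have "p \<in> K" if p: "p \<in> P" for p
      proof -
        have "p x \<in> D"
          using apply_in[OF p x] DOm by simp
        then obtain k where k: "k \<in> K" "p x = k x"
          unfolding D_def by blast
        then show ?thesis
          using overgroup_memI[OF K(1) stab p] by blast
      qed
      then show ?thesis
        using KP by blast
    next
      case 2
      then have "D = B"
        using DQ B BD block_eq[OF ip, of D B x] by blast
      then have "K \<subseteq> block_stab \<P>"
        using iff KP unfolding D_def by blast
      then show ?thesis
        using K(2) by blast
    qed
  qed
  then show ?thesis
    using block_stab_subgroup[OF ip] neq by (auto simp: maximal_subgroup_def)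
qed

end

text \<open>The point stabilizer has index \<open>card \<Omega>\<close> and is proper because a
  transitive group moves \<open>x\<close> to a second point. Block stabilizers map the maximal
  systems injectively to its maximal overgroups.\<close>

theorem solvable_maximal_systems_of_imprimitivity_le:
  assumes fin: "finite \<Omega>" and card2: "card \<Omega> \<ge> 2" and P: "subgroup P (BijGroup \<Omega>)"
    and solv: "solvable ((BijGroup \<Omega>)\<lparr>carrier := P\<rparr>)" and trans: "perm_transitive \<Omega> P"
  shows "card {\<P>. maximal_system_of_imprimitivity \<Omega> P \<P>} \<le> card \<Omega> - 1"
proof -
  obtain x where x: "x \<in> \<Omega>"
    using card2 by fastforce
  interpret transitive_perm_group \<Omega> P x
    using P trans x by (simp add: transitive_perm_group_def)
  have finP: "finite P"
    using finite_group fin by blast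
  have "point_stab \<noteq> P"
  proof
    assume eq: "point_stab = P"
    have "\<Omega> \<noteq> {x}"
      using card2 by auto
    then obtain y where "y \<in> \<Omega>" "y \<noteq> x"
      using x by blast
    then obtain g where "g \<in> P" "g x \<noteq> x"
      using reach[OF x] by metis
    then show False
      using eq by (auto simp: point_stab_def)
  qed
  then have "max_count point_stab \<G> \<le> card \<Omega> - 1"
    using solvable_max_count_le[OF _ solv point_stab_subgroup] finP card_rcosets_point_stab by simp
  moreover have "card {\<P>. maximal_system_of_imprimitivity \<Omega> P \<P>} \<le> max_count point_stab \<G>"
    unfolding max_count_def
  proof (rule card_inj_on_le)
    show "inj_on block_stab {\<P>. maximal_system_of_imprimitivity \<Omega> P \<P>}"
      by (rule inj_on_subset[OF block_stab_inj])
        (auto simp: maximal_system_of_imprimitivity_def system_of_imprimitivity_def)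
    show "block_stab ` {\<P>. maximal_system_of_imprimitivity \<Omega> P \<P>}
        \<subseteq> {M. maximal_subgroup M \<G> \<and> point_stab \<subseteq> M}"
      using block_stab_maximal point_stab_subset_block_stab
      by (auto simp: maximal_system_of_imprimitivity_def system_of_imprimitivity_def)
    have "{M. maximal_subgroup M \<G> \<and> point_stab \<subseteq> M} \<subseteq> Pow P"
      using maximal_subgroup_subset[of _ \<G>] by auto
    then show "finite {M. maximal_subgroup M \<G> \<and> point_stab \<subseteq> M}"
      using finP finite_subset by blast
  qed
  ultimately show ?thesis by linarith
qed

theorem theorem1p2:
  shows "(\<forall>(G :: ('a, 'c) monoid_scheme) H.
            group G \<and> finite (carrier G) \<and> solvable G \<and> subgroup H G \<and> H \<noteq> carrier G
            \<longrightarrow> max_count H G \<le> card (rcosets\<^bsub>G\<^esub> H) - 1)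
       \<and> (\<forall>(\<Omega> :: 'b set) P.
            finite \<Omega> \<and> card \<Omega> \<ge> 2 \<and> subgroup P (BijGroup \<Omega>) \<and>
            solvable ((BijGroup \<Omega>)\<lparr>carrier := P\<rparr>) \<and> perm_transitive \<Omega> P
            \<longrightarrow> card {\<P>. maximal_system_of_imprimitivity \<Omega> P \<P>} \<le> card \<Omega> - 1)"
  using group.solvable_max_count_le solvable_maximal_systems_of_imprimitivity_le by blast

end
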